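(* Let $n\ge1$ and suppose $\alpha,\lambda,\sigma$ are constants with $\alpha\in(0,n+2)$, $0<\lambda<\frac{n+2}{n}$, and $\sigma>\frac{2(n+2)-\alpha}{n}-\lambda$. Let $\varphi:(0,1)\to(0,\infty)$ be continuous with $\lim_{t\to0^+}\varphi(t)=\infty$. Then there exists a positive function $u\in C^\infty(\mathbb{R}^n\times(0,1))\cap L^\lambda(\mathbb{R}^n\times(0,1))$ satisfying $$0\le u_t-\Delta u\le \Big(\iint_{\mathbb{R}^n\times(0,1)}\Phi(x-y,t-s)^{\alpha/n}u(y,s)^\lambda\,dy\,ds\Big)\,u(x,t)^\sigma\quad\text{in }\mathbb{R}^n\times(0,1)$$ such that $u(0,t)\ne O(\varphi(t))$ as $t\to0^+$.
   Context: $\Phi$ is the heat kernel: $\Phi(x,t)=(4\pi t)^{-n/2}e^{-|x|^2/(4t)}$ for $t>0$ and $\Phi(x,t)=0$ for $t\le0$. *)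

theory Defs
  imports "HOL-Analysis.Analysis" "HOL-Library.Landau_Symbols"
begin

definition heat_kernel :: "'a::euclidean_space \<Rightarrow> real \<Rightarrow> real" where
  "heat_kernel x t = (if t > 0
     then (4 * pi * t) powr (- real DIM('a) / 2) * exp (- (norm x)\<^sup>2 / (4 * t))
     else 0)"

text \<open>C-infinity on an open set S: there is a family of iterated partial derivatives
  (indexed by lists of basis directions), all existing and continuous on S.\<close>
definition smooth_on :: "'a::euclidean_space set \<Rightarrow> ('a \<Rightarrow> real) \<Rightarrow> bool" where
  "smooth_on S f \<longleftrightarrow> (\<exists>D :: 'a list \<Rightarrow> 'a \<Rightarrow> real.
      (\<forall>z\<in>S. D [] z = f z) \<and>
      (\<forall>bs. \<forall>z\<in>S. \<forall>b\<in>Basis.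
          ((\<lambda>h. D bs (z + h *\<^sub>R b)) has_real_derivative D (b # bs) z) (at 0)) \<and>
      (\<forall>bs. continuous_on S (D bs)))"

definition time_deriv :: "('a::euclidean_space \<times> real \<Rightarrow> real) \<Rightarrow> 'a \<Rightarrow> real \<Rightarrow> real" where
  "time_deriv u x t = deriv (\<lambda>s. u (x, s)) t"

definition laplacian :: "('a::euclidean_space \<times> real \<Rightarrow> real) \<Rightarrow> 'a \<Rightarrow> real \<Rightarrow> real" where
  "laplacian u x t = (\<Sum>i\<in>Basis. deriv (\<lambda>r. deriv (\<lambda>s. u (x + s *\<^sub>R i, t)) r) 0)"

end

theory Submission
  imports Defs "HOL-Probability.Distributions" "HOL-Real_Asymp.Real_Asymp"
begin

text \<open>
  The solution is the heat kernel plus a series of pulses, i.e. heat kernels switched on smoothly: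
  \<open>m \<theta>((t - s) / \<tau>) \<Phi>(x, t - s + \<tau>)\<close>. The heat operator maps such a pulse to
  \<open>m \<theta>'((t - s) / \<tau>) / \<tau> \<Phi>(x, t - s + \<tau>)\<close>, which is nonnegative and lives on \<open>s \<le> t \<le> s + \<tau>\<close>.
  The pulses come in bursts near times tending to \<open>0\<close>. Inside a burst they climb a ladder of scales
  \<open>r\<close> shrinking geometrically, with \<open>m = r\<^sup>\<eta>\<close> for a small \<open>\<eta> > 0\<close> and \<open>\<tau> = c r\<close>; when a pulse is
  switched on, the preceding one (for the first pulse, the heat kernel itself) has width about
  \<open>sqrt r\<close> and height about \<open>r\<close> to the power \<open>\<eta> - n/2\<close>. Bounding \<open>u\<close> from below by that
  predecessor alone, the ratio of the two sides of the differential inequality is at most a constant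
  times \<open>r\<^sup>\<delta>\<close>, and \<open>\<delta> > 0\<close> for small \<open>\<eta>\<close> is exactly the hypothesis on \<open>\<sigma>\<close>. These ratios are
  summable and their sum is small if all scales are small. Since \<open>\<eta> < n/2\<close> the heights are unbounded
  along an infinite ladder, so stopping the \<open>j\<close>-th ladder late enough lets \<open>u(0, t)\<close> exceed
  \<open>j \<phi>(t)\<close> at the end of the burst.
\<close>

section \<open>Iterated partial derivatives and smoothness\<close>

text \<open>This fixes one canonical candidate for the family whose mere existence
  \<open>smooth_on\<close> asserts. As there, the head of the list is the derivative taken
  last.\<close>

primrec partials :: "('a::euclidean_space \<Rightarrow> real) \<Rightarrow> 'a list \<Rightarrow> 'a \<Rightarrow> real" where
  "partials f [] = f"
| "partials f (b # bs) = (\<lambda>z. deriv (\<lambda>h. partials f bs (z + h *\<^sub>R b)) 0)"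

lemma eventually_line_in_open:
  fixes z b :: "'a::euclidean_space"
  assumes "open S" "z \<in> S"
  shows "\<forall>\<^sub>F h in nhds (0::real). z + h *\<^sub>R b \<in> S"
proof -
  have "((\<lambda>h. z + h *\<^sub>R b) \<longlongrightarrow> z + 0 *\<^sub>R b) (nhds 0)"
    by (intro tendsto_intros filterlim_ident)
  then show ?thesis using topological_tendstoD[of _ z "nhds 0" S] assms by simp
qed

lemma line_derivative_cong:
  fixes z b :: "'a::euclidean_space"
  assumes "open S" "z \<in> S" "\<And>y. y \<in> S \<Longrightarrow> f y = g y"
  shows "((\<lambda>h. f (z + h *\<^sub>R b)) has_real_derivative d) (at 0)
     \<longleftrightarrow> ((\<lambda>h. g (z + h *\<^sub>R b)) has_real_derivative d) (at 0)"
proof (rule DERIV_cong_ev)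
  show "\<forall>\<^sub>F h in nhds 0. f (z + h *\<^sub>R b) = g (z + h *\<^sub>R b)"
    using eventually_line_in_open[OF assms(1,2)] by eventually_elim (rule assms(3))
qed auto

lemma line_deriv_cong:
  fixes z b :: "'a::euclidean_space"
  assumes "open S" "z \<in> S" "\<And>y. y \<in> S \<Longrightarrow> f y = g y"
  shows "deriv (\<lambda>h. f (z + h *\<^sub>R b)) 0 = deriv (\<lambda>h. g (z + h *\<^sub>R b)) 0"
  unfolding deriv_def using line_derivative_cong[of S z f g b] assms by simp

lemma partials_cong:
  assumes "open S" "\<And>y. y \<in> S \<Longrightarrow> f y = g y" "z \<in> S"
  shows "partials f bs z = partials g bs z"
  using assms(3)
proof (induction bs arbitrary: z)
  case Nil
  then show ?case using assms(2) by simp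
next
  case (Cons b bs)
  then show ?case using line_deriv_cong[OF assms(1), of z "partials f bs" "partials g bs"] by simp
qed

lemma partials_translate: "partials (\<lambda>z. f (z - v)) bs z = partials f bs (z - v)"
proof (induction bs arbitrary: z)
  case (Cons b bs)
  then show ?case by (simp add: algebra_simps)
qed simp

text \<open>Line derivatives are unique and, on an open set, depend only on values inside it. So
  every witness family for \<open>smooth_on\<close> coincides on \<open>S\<close> with
  \<open>partials\<close> along lists of basis vectors, and its properties carry over.\<close>

lemma smooth_on_partials_properties:
  fixes f :: "'a::euclidean_space \<Rightarrow> real"
  assumes "open S" "smooth_on S f" "bs \<in> lists Basis"
  shows smooth_on_continuous_partials: "continuous_on S (partials f bs)"
    and smooth_on_has_partials: "\<And>z b. z \<in> S \<Longrightarrow> b \<in> Basis \<Longrightarrow>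
      ((\<lambda>h. partials f bs (z + h *\<^sub>R b)) has_real_derivative partials f (b # bs) z) (at 0)"
proof -
  obtain D where D0: "\<forall>z\<in>S. D [] z = f z"
    and D1: "\<forall>bs. \<forall>z\<in>S. \<forall>b\<in>Basis.
          ((\<lambda>h. D bs (z + h *\<^sub>R b)) has_real_derivative D (b # bs) z) (at 0)"
    and D2: "\<forall>bs. continuous_on S (D bs)"
    using assms(2) unfolding smooth_on_def by blast
  have eq: "partials f cs z = D cs z" if "cs \<in> lists Basis" "z \<in> S" for cs z
    using that
  proof (induction cs arbitrary: z)
    case Nil
    then show ?case using D0 by simp
  next
    case (Cons b cs)
    have "partials f (b # cs) z = deriv (\<lambda>h. D cs (z + h *\<^sub>R b)) 0"
      using line_deriv_cong[OF assms(1), of z "partials f cs" "D cs"] Cons by simp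
    also have "\<dots> = D (b # cs) z"
      by (intro DERIV_imp_deriv D1[rule_format] Cons.prems Cons.hyps)
    finally show ?case .
  qed
  show "continuous_on S (partials f bs)"
    using D2 eq[OF assms(3)] continuous_on_cong[of S S "partials f bs" "D bs"] by simp
  fix z b assume z: "z \<in> S" and b: "b \<in> (Basis :: 'a set)"
  have "((\<lambda>h. D bs (z + h *\<^sub>R b)) has_real_derivative D (b # bs) z) (at 0)"
    using D1 z b by blast
  then show "((\<lambda>h. partials f bs (z + h *\<^sub>R b)) has_real_derivative partials f (b # bs) z) (at 0)"
    using line_derivative_cong[OF assms(1) z, of "partials f bs" "D bs" b] eq[OF assms(3)] eq[of "b # bs" z] assms(3) b z
    by (simp del: partials.simps)
qed

lemma smooth_on_partialsI:
  fixes f :: "'a::euclidean_space \<Rightarrow> real"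
  assumes "\<And>bs. bs \<in> lists Basis \<Longrightarrow> continuous_on S (partials f bs)"
    and "\<And>bs z b. bs \<in> lists Basis \<Longrightarrow> z \<in> S \<Longrightarrow> b \<in> Basis \<Longrightarrow>
      ((\<lambda>h. partials f bs (z + h *\<^sub>R b)) has_real_derivative partials f (b # bs) z) (at 0)"
  shows "smooth_on S f"
  unfolding smooth_on_def
  \<comment> \<open>\<open>smooth_on\<close> ranges over all lists. Outside
    \<open>lists Basis\<close> the value 0 is consistent: such a list stays outside when a basis
    vector is prepended, and the derivative of 0 is 0.\<close>
  by (rule exI[of _ "\<lambda>bs. if bs \<in> lists Basis then partials f bs else (\<lambda>_. 0)"])
     (use assms in \<open>auto simp del: partials.simps(2)\<close>)

text \<open>The witness families may change from one neighbourhood to the next, but each agrees with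
  the single global family \<open>partials\<close>, so the local statements glue.\<close>

lemma smooth_on_locally:
  fixes f :: "'a::euclidean_space \<Rightarrow> real"
  assumes "\<And>z. z \<in> S \<Longrightarrow> \<exists>U. open U \<and> z \<in> U \<and> smooth_on U f"
  shows "smooth_on S f"
proof (rule smooth_on_partialsI)
  fix bs :: "'a list" assume bs: "bs \<in> lists Basis"
  show "continuous_on S (partials f bs)"
    unfolding continuous_on_eq_continuous_within
  proof
    fix z assume "z \<in> S"
    then obtain U where U: "open U" "z \<in> U" "smooth_on U f" using assms by blast
    then have "isCont (partials f bs) z"
      using smooth_on_continuous_partials[OF U(1,3) bs] by (simp add: continuous_on_eq_continuous_at)
    then show "continuous (at z within S) (partials f bs)" by (rule continuous_at_imp_continuous_within)
  qed
  fix z b assume "z \<in> S" and b: "b \<in> (Basis :: 'a set)"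
  then obtain U where U: "open U" "z \<in> U" "smooth_on U f" using assms by blast
  show "((\<lambda>h. partials f bs (z + h *\<^sub>R b)) has_real_derivative partials f (b # bs) z) (at 0)"
    by (rule smooth_on_has_partials[OF U(1,3) bs U(2) b])
qed

lemma smooth_on_subset: "smooth_on T f \<Longrightarrow> S \<subseteq> T \<Longrightarrow> smooth_on S f"
  unfolding smooth_on_def
  by (erule exE, rule_tac x = D in exI) (auto intro: continuous_on_subset)

lemma smooth_on_cong:
  assumes "\<And>z. z \<in> S \<Longrightarrow> f z = g z" "smooth_on S g"
  shows "smooth_on S f"
  using assms unfolding smooth_on_def by simp

text \<open>Choosing once a derivative inside \<open>F\<close> for each member and direction, and
  iterating the choice, produces the whole family of derivatives; membership in \<open>F\<close>
  makes each of them continuous.\<close>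

lemma smooth_on_coinduct:
  fixes F :: "('a::euclidean_space \<Rightarrow> real) set"
  assumes "f \<in> F" and cont: "\<And>f. f \<in> F \<Longrightarrow> continuous_on S f"
    and der: "\<And>f b. f \<in> F \<Longrightarrow> b \<in> Basis \<Longrightarrow>
      \<exists>g\<in>F. \<forall>z\<in>S. ((\<lambda>h. f (z + h *\<^sub>R b)) has_real_derivative g z) (at 0)"
  shows "smooth_on S f"
proof -
  obtain G where G: "\<And>f b. f \<in> F \<Longrightarrow> b \<in> Basis \<Longrightarrow> G f b \<in> F \<and>
      (\<forall>z\<in>S. ((\<lambda>h. f (z + h *\<^sub>R b)) has_real_derivative G f b z) (at 0))"
    using der by metis
  \<comment> \<open>Entries outside \<open>Basis\<close> are skipped, so that \<open>D bs\<close>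
    lies in \<open>F\<close> for every list.\<close>
  define D where "D = (\<lambda>bs. foldr (\<lambda>b f. if b \<in> Basis then G f b else f) bs f)"
  have DF: "D bs \<in> F" for bs
    by (induction bs) (use assms(1) G in \<open>auto simp: D_def\<close>)
  have "D (b # bs) = G (D bs) b" if "b \<in> Basis" for b bs
    using that by (simp add: D_def)
  then show ?thesis
    unfolding smooth_on_def using G DF cont
    by (intro exI[of _ D]) (auto simp: D_def)
qed

section \<open>Smoothness via algebras of functions closed under differentiation\<close>

inductive_set function_algebra :: "('a \<Rightarrow> real) set \<Rightarrow> ('a \<Rightarrow> real) set" for G where
  generator: "g \<in> G \<Longrightarrow> g \<in> function_algebra G"
| const: "(\<lambda>_. c) \<in> function_algebra G"
| add: "f \<in> function_algebra G \<Longrightarrow> g \<in> function_algebra G \<Longrightarrow> (\<lambda>z. f z + g z) \<in> function_algebra G"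
| mult: "f \<in> function_algebra G \<Longrightarrow> g \<in> function_algebra G \<Longrightarrow> (\<lambda>z. f z * g z) \<in> function_algebra G"

text \<open>By the sum and product rules, closure under differentiation passes from the generators
  to the whole algebra, to which \<open>smooth_on_coinduct\<close> then applies. For an explicit
  function it remains to find a finite list of generator types.\<close>

lemma smooth_on_function_algebra:
  fixes G :: "('a::euclidean_space \<Rightarrow> real) set"
  assumes "f \<in> function_algebra G" and cont: "\<And>g. g \<in> G \<Longrightarrow> continuous_on S g"
    and der: "\<And>g b. g \<in> G \<Longrightarrow> b \<in> Basis \<Longrightarrow> \<exists>g'\<in>function_algebra G.
      \<forall>z\<in>S. ((\<lambda>h. g (z + h *\<^sub>R b)) has_real_derivative g' z) (at 0)"
  shows "smooth_on S f"
proof (rule smooth_on_coinduct[OF assms(1)])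
  fix f assume f: "f \<in> function_algebra G"
  then show "continuous_on S f"
    by induction (auto intro: cont continuous_on_add continuous_on_mult)
  fix b :: 'a assume b: "b \<in> Basis"
  from f show "\<exists>g\<in>function_algebra G. \<forall>z\<in>S. ((\<lambda>h. f (z + h *\<^sub>R b)) has_real_derivative g z) (at 0)"
  proof induction
    case (generator g)
    then show ?case using der b by blast
  next
    case (const c)
    then show ?case by (intro bexI[of _ "\<lambda>_. 0"]) (auto intro: function_algebra.const)
  next
    case (add f g)
    then obtain f' g' where *: "f' \<in> function_algebra G" "g' \<in> function_algebra G"
      and d: "\<forall>z\<in>S. ((\<lambda>h. f (z + h *\<^sub>R b)) has_real_derivative f' z) (at 0)"
      "\<forall>z\<in>S. ((\<lambda>h. g (z + h *\<^sub>R b)) has_real_derivative g' z) (at 0)" by blast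
    show ?case
      by (rule bexI[of _ "\<lambda>z. f' z + g' z"])
         (use d in \<open>auto intro!: derivative_eq_intros function_algebra.add *\<close>)
  next
    case (mult f g)
    then obtain f' g' where *: "f' \<in> function_algebra G" "g' \<in> function_algebra G"
      and d: "\<forall>z\<in>S. ((\<lambda>h. f (z + h *\<^sub>R b)) has_real_derivative f' z) (at 0)"
      "\<forall>z\<in>S. ((\<lambda>h. g (z + h *\<^sub>R b)) has_real_derivative g' z) (at 0)" by blast
    show ?case
    proof (rule bexI[of _ "\<lambda>z. f' z * g z + f z * g' z"])
      show "\<forall>z\<in>S. ((\<lambda>h. f (z + h *\<^sub>R b) * g (z + h *\<^sub>R b)) has_real_derivative
         f' z * g z + f z * g' z) (at 0)"
        using d by (auto intro!: derivative_eq_intros)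
    qed (intro function_algebra.add function_algebra.mult * mult.hyps)
  qed
qed

text \<open>The algebra generated by all derivatives of members of \<open>F\<close> is closed under
  differentiation. Since \<open>D g []\<close> equals \<open>g\<close> only on \<open>S\<close>, the
  given function is first replaced by one that agrees with it on \<open>S\<close>.\<close>

lemma smooth_on_function_algebra_closed:
  fixes f :: "'a::euclidean_space \<Rightarrow> real"
  assumes "\<And>g. g \<in> F \<Longrightarrow> smooth_on S g" "f \<in> function_algebra F"
  shows "smooth_on S f"
proof -
  obtain D where D: "\<And>g. g \<in> F \<Longrightarrow> (\<forall>z\<in>S. D g [] z = g z) \<and>
      (\<forall>bs. \<forall>z\<in>S. \<forall>b\<in>Basis.
          ((\<lambda>h. D g bs (z + h *\<^sub>R b)) has_real_derivative D g (b # bs) z) (at 0)) \<and>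
      (\<forall>bs. continuous_on S (D g bs))"
    using assms(1) unfolding smooth_on_def by metis
  define G where "G = {D g bs |g bs. g \<in> F}"
  have "\<exists>f'\<in>function_algebra G. \<forall>z\<in>S. f z = f' z"
    using assms(2)
  proof induction
    case (generator g)
    then show ?case using D by (intro bexI[of _ "D g []"] function_algebra.generator) (auto simp: G_def)
  next
    case (const c)
    then show ?case by (intro bexI[of _ "\<lambda>_. c"]) (auto intro: function_algebra.const)
  next
    case (add f g)
    then obtain f' g' where "f' \<in> function_algebra G" "g' \<in> function_algebra G"
      "\<forall>z\<in>S. f z = f' z" "\<forall>z\<in>S. g z = g' z" by blast
    then show ?case by (intro bexI[OF _ function_algebra.add[of f' _ g']]) auto
  next
    case (mult f g)
    then obtain f' g' where "f' \<in> function_algebra G" "g' \<in> function_algebra G"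
      "\<forall>z\<in>S. f z = f' z" "\<forall>z\<in>S. g z = g' z" by blast
    then show ?case by (intro bexI[OF _ function_algebra.mult[of f' _ g']]) auto
  qed
  then obtain f' where f': "f' \<in> function_algebra G" "\<And>z. z \<in> S \<Longrightarrow> f z = f' z" by blast
  have "smooth_on S f'"
  proof (rule smooth_on_function_algebra[OF f'(1)])
    fix g assume "g \<in> G"
    then obtain g0 bs where g: "g0 \<in> F" "g = D g0 bs" by (auto simp: G_def)
    then show "continuous_on S g" using D by blast
    fix b :: 'a assume "b \<in> Basis"
    then show "\<exists>g'\<in>function_algebra G. \<forall>z\<in>S. ((\<lambda>h. g (z + h *\<^sub>R b)) has_real_derivative g' z) (at 0)"
      using D g by (intro bexI[of _ "D g0 (b # bs)"] function_algebra.generator) (auto simp: G_def)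
  qed
  then show ?thesis using smooth_on_cong f'(2) by blast
qed

lemma smooth_on_mult:
  fixes f g :: "'a::euclidean_space \<Rightarrow> real"
  assumes "smooth_on S f" "smooth_on S g"
  shows "smooth_on S (\<lambda>z. f z * g z)"
proof (rule smooth_on_function_algebra_closed[of "{f, g}"])
  show "(\<lambda>z. f z * g z) \<in> function_algebra {f, g}"
    by (intro function_algebra.mult function_algebra.generator) auto
qed (use assms in auto)

lemma smooth_on_add:
  fixes f g :: "'a::euclidean_space \<Rightarrow> real"
  assumes "smooth_on S f" "smooth_on S g"
  shows "smooth_on S (\<lambda>z. f z + g z)"
proof (rule smooth_on_function_algebra_closed[of "{f, g}"])
  show "(\<lambda>z. f z + g z) \<in> function_algebra {f, g}"
    by (intro function_algebra.add function_algebra.generator) auto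
qed (use assms in auto)

lemma smooth_on_const: "smooth_on S (\<lambda>_. c)"
  by (rule smooth_on_function_algebra_closed[of "{}", OF _ function_algebra.const]) auto

section \<open>A smooth step function\<close>

text \<open>Derivatives of these functions are again linear combinations of them, so that together
  they generate an algebra closed under differentiation.\<close>

definition flat :: "nat \<Rightarrow> real \<Rightarrow> real" where
  "flat k t = (if t > 0 then exp (- 1 / t) / t ^ k else 0)"

lemma flat_nonneg: "0 \<le> flat k t"
  by (simp add: flat_def)

text \<open>A single term of the exponential series, of order \<open>k + 1\<close> at
  \<open>1 / t\<close>, already outweighs the pole \<open>1 / t ^ k\<close> with one power of
  \<open>t\<close> to spare. The linear bound controls the difference quotient at 0.\<close>

lemma flat_le: "flat k t \<le> fact (Suc k) * \<bar>t\<bar>"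
proof (cases "t > 0")
  case True
  have "(1 / t) ^ Suc k / fact (Suc k) \<le> exp (1 / t)"
  proof -
    have "(\<Sum>n\<in>{Suc k}. inverse (fact n) *\<^sub>R (1 / t) ^ n) \<le> exp (1 / t)"
      unfolding exp_def by (rule sum_le_suminf[OF summable_exp_generic]) (use True in auto)
    then show ?thesis by (simp add: field_simps)
  qed
  then have "1 \<le> exp (1 / t) * (fact (Suc k) * t ^ Suc k)"
    using True by (simp add: field_simps del: fact_Suc)
  then have "exp (- (1 / t)) \<le> fact (Suc k) * t ^ Suc k"
    by (simp add: exp_minus field_simps del: fact_Suc)
  then show ?thesis using True by (simp add: flat_def field_simps del: fact_Suc)
next
  case False
  then have "flat k t = 0" by (simp add: flat_def)
  then show ?thesis by simp
qed

lemma flat_has_derivative: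
  "(flat k has_real_derivative flat (k + 2) t - real k * flat (k + 1) t) (at t)"
proof -
  consider "t > 0" | "t < 0" | "t = 0" by linarith
  then show ?thesis
  proof cases
    case 1
    have "((\<lambda>t. exp (- 1 / t) / t ^ k) has_real_derivative flat (k + 2) t - real k * flat (k + 1) t) (at t)"
    proof (cases k)
      case (Suc m)
      have "t ^ m = t * t ^ (m - Suc 0)" if "m > 0"
        using that by (cases m) auto
      then show ?thesis using 1 Suc
        by (cases "m = 0") (auto intro!: derivative_eq_intros simp: flat_def field_simps power2_eq_square)
    qed (use 1 in \<open>auto intro!: derivative_eq_intros simp: flat_def field_simps power2_eq_square\<close>)
    moreover have "\<forall>\<^sub>F s in nhds t. flat k s = exp (- 1 / s) / s ^ k"
      using eventually_nhds_in_open[of "{0<..}" t] 1 by (auto elim!: eventually_mono simp: flat_def)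
    ultimately show ?thesis by (subst DERIV_cong_ev[OF refl _ refl])
  next
    case 2
    have "\<forall>\<^sub>F s in nhds t. flat k s = 0"
      using eventually_nhds_in_open[of "{..<0}" t] 2 by (auto elim!: eventually_mono simp: flat_def)
    then have "(flat k has_real_derivative 0) (at t) \<longleftrightarrow> ((\<lambda>_. 0) has_real_derivative 0) (at t)"
      by (intro DERIV_cong_ev) auto
    then show ?thesis using 2 by (simp add: flat_def)
  next
    case 3
    \<comment> \<open>The quotient \<open>flat k h / h\<close> is \<open>flat (Suc k) h\<close> on
      both sides of 0, so \<open>flat_le\<close> one order higher forces it to 0.\<close>
    have "((\<lambda>h. flat k h / h) \<longlongrightarrow> 0) (at 0)"
    proof (rule Lim_null_comparison)
      show "\<forall>\<^sub>F h in at 0. norm (flat k h / h) \<le> fact (Suc (Suc k)) * \<bar>h\<bar>"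
      proof (rule always_eventually, rule allI)
        fix h :: real
        have "norm (flat k h / h) = flat (Suc k) h"
          by (simp add: flat_def field_simps)
        then show "norm (flat k h / h) \<le> fact (Suc (Suc k)) * \<bar>h\<bar>"
          using flat_le[of "Suc k" h] by simp
      qed
      show "((\<lambda>h::real. fact (Suc (Suc k)) * \<bar>h\<bar>) \<longlongrightarrow> 0) (at 0)"
        by (auto intro!: tendsto_eq_intros)
    qed
    then show ?thesis using 3 by (simp add: DERIV_def flat_def)
  qed
qed

lemma flat_has_derivative_compose [derivative_intros]:
  "(f has_real_derivative f') (at x) \<Longrightarrow>
   ((\<lambda>x. flat k (f x)) has_real_derivative (flat (k + 2) (f x) - real k * flat (k + 1) (f x)) * f') (at x)"
  by (rule DERIV_chain2[OF flat_has_derivative])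

lemma continuous_flat: "continuous_on UNIV (flat k)"
  using flat_has_derivative by (meson DERIV_isCont continuous_at_imp_continuous_on)

text \<open>The numbers \<open>t\<close> and \<open>1 - t\<close> are never both nonpositive, so the
  denominator in \<open>step\<close> has no zero.\<close>

lemma flat_sum_pos: "flat 0 t + flat 0 (1 - t) > 0"
  by (auto simp: flat_def intro: add_pos_pos)

definition step :: "real \<Rightarrow> real" where
  "step t = flat 0 t / (flat 0 t + flat 0 (1 - t))"

text \<open>The quotient rule, with \<open>flat 2\<close> as derivative of \<open>flat 0\<close>,
  after the two terms \<open>flat 2 t * flat 0 t\<close> have cancelled; what is left is visibly
  nonnegative.\<close>

definition step' :: "real \<Rightarrow> real" where
  "step' t = (flat 2 t * flat 0 (1 - t) + flat 0 t * flat 2 (1 - t)) / (flat 0 t + flat 0 (1 - t))\<^sup>2"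

lemma step_has_derivative: "(step has_real_derivative step' t) (at t)"
  unfolding step_def [abs_def] step'_def using flat_sum_pos[of t]
  by (auto intro!: derivative_eq_intros simp: numeral_2_eq_2 power2_eq_square field_simps)

lemma step_nonneg: "0 \<le> step t" and step_le_1: "step t \<le> 1"
  using flat_sum_pos[of t] flat_nonneg[of 0 t] flat_nonneg[of 0 "1 - t"]
  by (auto simp: step_def)

lemma step_eq_0: "t \<le> 0 \<Longrightarrow> step t = 0" and step_eq_1: "t \<ge> 1 \<Longrightarrow> step t = 1"
  using flat_sum_pos[of t] by (auto simp: step_def flat_def)

lemma step'_nonneg: "0 \<le> step' t"
  by (simp add: step'_def flat_nonneg)

lemma step'_eq_0: "t \<le> 0 \<or> t \<ge> 1 \<Longrightarrow> step' t = 0"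
  by (auto simp: step'_def flat_def)

lemma step'_bounded: obtains C where "C > 0" "\<And>t. step' t \<le> C"
proof -
  have "continuous_on {0..1} step'"
    unfolding step'_def [abs_def] using flat_sum_pos
    by (intro continuous_intros continuous_on_compose2[OF continuous_flat]) (auto simp: less_imp_neq[symmetric])
  then have "bounded (step' ` {0..1})"
    by (intro compact_imp_bounded compact_continuous_image) auto
  then obtain C where C: "C > 0" "\<And>t. t \<in> {0..1} \<Longrightarrow> \<bar>step' t\<bar> \<le> C"
    by (force simp: bounded_pos)
  have "step' t \<le> C" for t
    using C(1) C(2)[of t] step'_eq_0[of t] by (cases "t \<in> {0..1}") auto
  then show ?thesis using that C(1) by blast
qed

lemma smooth_on_step:
  assumes "\<tau> \<noteq> 0"
  shows "smooth_on UNIV (\<lambda>z::'a::euclidean_space \<times> real. step ((snd z - s) / \<tau>))"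
proof -
  define p where "p = (\<lambda>z::'a \<times> real. (snd z - s) / \<tau>)"
  define den where "den = (\<lambda>z. 1 / (flat 0 (p z) + flat 0 (1 - p z)))"
  \<comment> \<open>The reciprocal of the denominator is a generator of its own: its derivative is
    its square times a combination of the functions \<open>flat 2\<close>, so the quotient
    \<open>step\<close> becomes a product inside the algebra.\<close>
  define G where "G = insert den (range (\<lambda>k z. flat k (p z)) \<union> range (\<lambda>k z. flat k (1 - p z)))"
  note gen = function_algebra.generator[of _ G]
  have G1: "(\<lambda>z. flat k (p z)) \<in> function_algebra G" "(\<lambda>z. flat k (1 - p z)) \<in> function_algebra G"
    "den \<in> function_algebra G" for k
    by (rule gen; auto simp: G_def)+
  have cf: "continuous_on UNIV (\<lambda>z. flat k (p z))" "continuous_on UNIV (\<lambda>z. flat k (1 - p z))" for k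
    using \<open>\<tau> \<noteq> 0\<close> unfolding p_def
    by (intro continuous_on_compose2[OF continuous_flat] continuous_intros; simp)+
  have dp: "((\<lambda>h. p (z + h *\<^sub>R b)) has_real_derivative snd b / \<tau>) (at 0)" for z b
    using \<open>\<tau> \<noteq> 0\<close> unfolding p_def by (auto intro!: derivative_eq_intros)
  have *: "(\<lambda>z. flat 0 (p z) * den z) \<in> function_algebra G"
    by (intro function_algebra.mult G1)
  have "smooth_on UNIV (\<lambda>z. flat 0 (p z) * den z)"
  proof (rule smooth_on_function_algebra[OF *])
    fix g assume g: "g \<in> G"
    have "continuous_on UNIV den"
      unfolding den_def using flat_sum_pos
      by (intro continuous_intros cf) (auto simp: less_imp_neq[symmetric])
    then show "continuous_on UNIV g"
      using g cf unfolding G_def by blast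
    fix b :: "'a \<times> real"
    from g consider "g = den" | k where "g = (\<lambda>z. flat k (p z))" | k where "g = (\<lambda>z. flat k (1 - p z))"
      unfolding G_def by blast
    then show "\<exists>g'\<in>function_algebra G. \<forall>z\<in>UNIV. ((\<lambda>h. g (z + h *\<^sub>R b)) has_real_derivative g' z) (at 0)"
    proof cases
      case 1
      show ?thesis
      proof (rule bexI[of _ "\<lambda>z. (den z * den z) * ((-1) * (snd b / \<tau>) * (flat 2 (p z) + (-1) * flat 2 (1 - p z)))"])
        show "\<forall>z\<in>UNIV. ((\<lambda>h. g (z + h *\<^sub>R b)) has_real_derivative
           (den z * den z) * ((-1) * (snd b / \<tau>) * (flat 2 (p z) + (-1) * flat 2 (1 - p z)))) (at 0)"
        proof
          fix z
          show "((\<lambda>h. g (z + h *\<^sub>R b)) has_real_derivative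
           (den z * den z) * ((-1) * (snd b / \<tau>) * (flat 2 (p z) + (-1) * flat 2 (1 - p z)))) (at 0)"
            unfolding 1 den_def using flat_sum_pos[of "p z"]
            by (auto intro!: derivative_eq_intros dp simp: numeral_2_eq_2 power2_eq_square divide_simps)
               (simp add: algebra_simps)
        qed
      qed (intro function_algebra.add function_algebra.mult function_algebra.const G1)
    next
      case (2 k)
      show ?thesis
      proof (rule bexI[of _ "\<lambda>z. (flat (k + 2) (p z) + (- real k) * flat (k + 1) (p z)) * (snd b / \<tau>)"])
        show "\<forall>z\<in>UNIV. ((\<lambda>h. g (z + h *\<^sub>R b)) has_real_derivative
            (flat (k + 2) (p z) + (- real k) * flat (k + 1) (p z)) * (snd b / \<tau>)) (at 0)"
          by (auto simp: 2 intro!: derivative_eq_intros dp)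
      qed (intro function_algebra.add function_algebra.mult function_algebra.const G1)
    next
      case (3 k)
      show ?thesis
      proof (rule bexI[of _ "\<lambda>z. (flat (k + 2) (1 - p z) + (- real k) * flat (k + 1) (1 - p z)) * (- (snd b / \<tau>))"])
        show "\<forall>z\<in>UNIV. ((\<lambda>h. g (z + h *\<^sub>R b)) has_real_derivative
            (flat (k + 2) (1 - p z) + (- real k) * flat (k + 1) (1 - p z)) * (- (snd b / \<tau>))) (at 0)"
          by (auto simp: 3 intro!: derivative_eq_intros dp)
      qed (intro function_algebra.add function_algebra.mult function_algebra.const G1)
    qed
  qed
  then show ?thesis by (simp add: den_def p_def step_def)
qed

section \<open>The heat kernel\<close>

abbreviation heat_fun :: "'a::euclidean_space \<times> real \<Rightarrow> real" where
  "heat_fun z \<equiv> heat_kernel (fst z) (snd z)"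

lemma heat_kernel_pos: "t > 0 \<Longrightarrow> heat_kernel x t > 0"
  by (simp add: heat_kernel_def)

lemma heat_kernel_nonneg: "heat_kernel x t \<ge> 0"
  by (simp add: heat_kernel_def)

text \<open>One formula covers time and all space directions. The derivative is the kernel times a
  polynomial in \<open>x\<close>, \<open>1 / t\<close> and the direction, which is what lets a
  finite list of generator types close up.\<close>

lemma heat_fun_has_line_derivative:
  fixes z b :: "'a::euclidean_space \<times> real"
  assumes "snd z > 0"
  shows "((\<lambda>h. heat_fun (z + h *\<^sub>R b)) has_real_derivative
    heat_fun z * (snd b * ((norm (fst z))\<^sup>2 / (4 * (snd z)\<^sup>2) - real DIM('a) / (2 * snd z))
                  - (fst z \<bullet> fst b) / (2 * snd z))) (at 0)"
proof -
  obtain x t where z: "z = (x, t)" by fastforce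
  obtain v q where b: "b = (v, q)" by fastforce
  have t: "t > 0" using assms z by simp
  define n where "n = real DIM('a)"
  have n2: "(norm (x + h *\<^sub>R v))\<^sup>2 = x \<bullet> x + 2 * h * (x \<bullet> v) + h * h * (v \<bullet> v)" for h
    unfolding power2_norm_eq_inner by (simp add: algebra_simps inner_commute)
  have ev: "\<forall>\<^sub>F h in nhds (0::real). t + h * q > 0"
  proof -
    have "((\<lambda>h. t + h * q) \<longlongrightarrow> t + 0 * q) (nhds 0)"
      by (intro tendsto_intros filterlim_ident)
    then show ?thesis using order_tendstoD(1)[of _ t "nhds 0" 0] t by simp
  qed
  have "((\<lambda>h. (4 * pi * (t + h * q)) powr (- n / 2) *
       exp (- (x \<bullet> x + 2 * h * (x \<bullet> v) + h * h * (v \<bullet> v)) / (4 * (t + h * q))))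
     has_real_derivative heat_kernel x t * (q * ((norm x)\<^sup>2 / (4 * t\<^sup>2) - n / (2 * t))
                  - (x \<bullet> v) / (2 * t))) (at 0)"
  proof -
    have "(pi * (t * 4)) powr ((- n - 2) / 2) = (pi * (t * 4)) powr (- (n / 2)) / (pi * (t * 4))"
      using t by (simp add: diff_divide_distrib powr_diff)
    then show ?thesis
      using t unfolding heat_kernel_def n_def[symmetric] power2_norm_eq_inner
      by (auto intro!: derivative_eq_intros) (simp add: field_simps power2_eq_square)
  qed
  moreover have "\<forall>\<^sub>F h in nhds 0. heat_fun (z + h *\<^sub>R b) = (4 * pi * (t + h * q)) powr (- n / 2) *
       exp (- (x \<bullet> x + 2 * h * (x \<bullet> v) + h * h * (v \<bullet> v)) / (4 * (t + h * q)))"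
    using ev by eventually_elim (simp add: z b heat_kernel_def n_def n2)
  ultimately show ?thesis unfolding z b n_def
    by (subst DERIV_cong_ev[OF refl _ refl]) (simp_all add: z b)
qed

lemma smooth_on_heat_fun:
  "smooth_on (UNIV \<times> {0<..}) (heat_fun :: 'a::euclidean_space \<times> real \<Rightarrow> real)"
proof -
  \<comment> \<open>The logarithmic derivative of the kernel is a polynomial in these functions:
    \<open>(norm x)^2\<close> differentiates to an inner product, \<open>1 / t\<close> to a multiple
    of its square, an inner product to a constant.\<close>
  define G :: "('a \<times> real \<Rightarrow> real) set" where
    "G = insert heat_fun (insert (\<lambda>z. (norm (fst z))\<^sup>2) (insert (\<lambda>z. 1 / snd z) (range (\<lambda>v z. fst z \<bullet> v))))"
  note gen = function_algebra.generator[of _ G]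
  have G1: "(\<lambda>z. heat_fun z) \<in> function_algebra G" "(\<lambda>z. (norm (fst z))\<^sup>2) \<in> function_algebra G"
    "(\<lambda>z. 1 / snd z) \<in> function_algebra G" "(\<lambda>z. fst z \<bullet> v) \<in> function_algebra G" for v
    by (rule gen; auto simp: G_def)+
  note alg = function_algebra.add function_algebra.mult function_algebra.const G1
  show ?thesis
  proof (rule smooth_on_function_algebra[of _ G])
    show "heat_fun \<in> function_algebra G" by (intro G1)
    fix g assume "g \<in> G"
    then consider "g = heat_fun" | "g = (\<lambda>z. (norm (fst z))\<^sup>2)" | "g = (\<lambda>z. 1 / snd z)" | v where "g = (\<lambda>z. fst z \<bullet> v)"
      unfolding G_def by blast
    then show "continuous_on (UNIV \<times> {0<..}) g"
    proof cases
      case 1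
      have "continuous_on (UNIV \<times> {0<..}) (\<lambda>z::'a \<times> real. (4 * pi * snd z) powr (- real DIM('a) / 2) *
          exp (- (norm (fst z))\<^sup>2 / (4 * snd z)))"
        by (intro continuous_intros) auto
      then show ?thesis unfolding 1
        by (rule continuous_on_eq) (auto simp: heat_kernel_def)
    qed (auto intro!: continuous_intros)
  next
    fix g and b :: "'a \<times> real" assume "g \<in> G"
    then consider "g = heat_fun" | "g = (\<lambda>z. (norm (fst z))\<^sup>2)" | "g = (\<lambda>z. 1 / snd z)" | v where "g = (\<lambda>z. fst z \<bullet> v)"
      unfolding G_def by blast
    then show "\<exists>g'\<in>function_algebra G. \<forall>z\<in>UNIV \<times> {0<..}. ((\<lambda>h. g (z + h *\<^sub>R b)) has_real_derivative g' z) (at 0)"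
    proof cases
      case 1
      show ?thesis
      proof (rule bexI)
        show "(\<lambda>z. heat_fun z * (snd b * ((1/4) * (norm (fst z))\<^sup>2 * (1 / snd z) * (1 / snd z) + (- real DIM('a) / 2) * (1 / snd z))
                  + (-1/2) * (fst z \<bullet> fst b) * (1 / snd z))) \<in> function_algebra G"
          by (intro alg)
        show "\<forall>z\<in>UNIV \<times> {0<..}. ((\<lambda>h. g (z + h *\<^sub>R b)) has_real_derivative
            heat_fun z * (snd b * ((1/4) * (norm (fst z))\<^sup>2 * (1 / snd z) * (1 / snd z) + (- real DIM('a) / 2) * (1 / snd z))
                  + (-1/2) * (fst z \<bullet> fst b) * (1 / snd z))) (at 0)"
        proof
          fix z :: "'a \<times> real" assume "z \<in> UNIV \<times> {0<..}"
          then have "snd z > 0" by auto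
          from heat_fun_has_line_derivative[OF this, of b]
          show "((\<lambda>h. g (z + h *\<^sub>R b)) has_real_derivative
            heat_fun z * (snd b * ((1/4) * (norm (fst z))\<^sup>2 * (1 / snd z) * (1 / snd z) + (- real DIM('a) / 2) * (1 / snd z))
                  + (-1/2) * (fst z \<bullet> fst b) * (1 / snd z))) (at 0)"
            unfolding 1 by (rule DERIV_cong) (simp add: power2_eq_square)
        qed
      qed
    next
      case 2
      show ?thesis
      proof (rule bexI)
        show "(\<lambda>z. 2 * (fst z \<bullet> fst b)) \<in> function_algebra G"
          by (intro alg)
        have n2: "(norm (x + h *\<^sub>R v))\<^sup>2 = x \<bullet> x + 2 * h * (x \<bullet> v) + h * h * (v \<bullet> v)" for h and x v :: 'a
          unfolding power2_norm_eq_inner by (simp add: algebra_simps inner_commute)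
        show "\<forall>z\<in>UNIV \<times> {0<..}. ((\<lambda>h. g (z + h *\<^sub>R b)) has_real_derivative 2 * (fst z \<bullet> fst b)) (at 0)"
          unfolding 2 by (auto simp: n2 intro!: derivative_eq_intros)
      qed
    next
      case 3
      show ?thesis
      proof (rule bexI)
        show "(\<lambda>z. (- snd b) * (1 / snd z) * (1 / snd z)) \<in> function_algebra G"
          by (intro alg)
        show "\<forall>z\<in>UNIV \<times> {0<..}. ((\<lambda>h. g (z + h *\<^sub>R b)) has_real_derivative (- snd b) * (1 / snd z) * (1 / snd z)) (at 0)"
          unfolding 3 by (auto intro!: derivative_eq_intros simp: power2_eq_square)
      qed
    next
      case (4 v)
      show ?thesis
      proof (rule bexI)
        show "(\<lambda>z. fst b \<bullet> v) \<in> function_algebra G"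
          by (intro alg)
        show "\<forall>z\<in>UNIV \<times> {0<..}. ((\<lambda>h. g (z + h *\<^sub>R b)) has_real_derivative fst b \<bullet> v) (at 0)"
          unfolding 4 by (auto intro!: derivative_eq_intros simp: inner_left_distrib)
      qed
    qed
  qed
qed

section \<open>The heat operator and kernels with a time-dependent factor\<close>

lemma deriv_shift_0: "deriv (\<lambda>h. f (t + h)) 0 = deriv f (t::real)"
  unfolding deriv_def using DERIV_shift[of f _ 0 t] by (simp add: add.commute)

lemma time_deriv_eq_partials: "time_deriv u x t = partials u [(0, 1)] (x, t)"
  using deriv_shift_0[of "\<lambda>s. u (x, s)" t] by (simp add: time_deriv_def)

lemma laplacian_eq_partials: "laplacian u x t = (\<Sum>i\<in>Basis. partials u [(i, 0), (i, 0)] (x, t))"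
proof -
  have "deriv (\<lambda>s. u (x + s *\<^sub>R i, t)) r = deriv (\<lambda>h. u (x + r *\<^sub>R i + h *\<^sub>R i, t)) 0" for r i
    using deriv_shift_0[of "\<lambda>s. u (x + s *\<^sub>R i, t)" r] by (simp add: algebra_simps)
  then show ?thesis by (simp add: laplacian_def)
qed

definition heat_op :: "('a::euclidean_space \<times> real \<Rightarrow> real) \<Rightarrow> 'a \<times> real \<Rightarrow> real" where
  "heat_op u z = partials u [(0, 1)] z - (\<Sum>i\<in>Basis. partials u [(i, 0), (i, 0)] z)"

lemma heat_op_eq: "time_deriv u x t - laplacian u x t = heat_op u (x, t)"
  by (simp add: heat_op_def time_deriv_eq_partials laplacian_eq_partials)

lemma heat_op_cong:
  assumes "open S" "\<And>y. y \<in> S \<Longrightarrow> f y = g y" "z \<in> S"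
  shows "heat_op f z = heat_op g z"
  unfolding heat_op_def using partials_cong[OF assms(1), of f g z] assms(2,3) by (simp del: partials.simps)

text \<open>The factor \<open>a\<close> depends on time alone and commutes with the Laplacian, and
  the kernel solves the heat equation, so only the term with the derivative of \<open>a\<close>
  survives.\<close>

lemma heat_op_modulated_kernel:
  fixes z :: "'a::euclidean_space \<times> real"
  assumes t: "snd z > b" and a: "(a has_real_derivative a') (at (snd z))"
  shows "heat_op (\<lambda>z. a (snd z) * heat_kernel (fst z) (snd z - b)) z
    = a' * heat_kernel (fst z) (snd z - b)"
proof -
  define S :: "('a \<times> real) set" where "S = UNIV \<times> {b<..}"
  have S: "open S" "z \<in> S" unfolding S_def using t by (auto intro: open_Times simp: mem_Times_iff)
  define K where "K = (\<lambda>z::'a \<times> real. heat_kernel (fst z) (snd z - b))"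
  have dK: "((\<lambda>h. K (y + h *\<^sub>R v)) has_real_derivative
    K y * (snd v * ((norm (fst y))\<^sup>2 / (4 * (snd y - b)\<^sup>2) - real DIM('a) / (2 * (snd y - b)))
                  - (fst y \<bullet> fst v) / (2 * (snd y - b)))) (at 0)" if "y \<in> S" for y v
  proof -
    have "snd (y - (0, b)) > 0" using that by (auto simp: S_def)
    from heat_fun_has_line_derivative[OF this, of v]
    show ?thesis by (simp add: K_def algebra_simps)
  qed
  have "((\<lambda>h. a (snd (z + h *\<^sub>R (0, 1)))) has_real_derivative a') (at 0)"
    using a DERIV_shift[of a a' 0 "snd z"] by (simp add: add.commute)
  then have "((\<lambda>h. a (snd (z + h *\<^sub>R (0,1))) * K (z + h *\<^sub>R (0,1))) has_real_derivative
     a' * K z + a (snd z) * (K z * ((norm (fst z))\<^sup>2 / (4 * (snd z - b)\<^sup>2) - real DIM('a) / (2 * (snd z - b))))) (at 0)"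
    using dK[OF S(2), of "(0,1)"]
    by (auto intro!: derivative_eq_intros simp: zero_prod_def[symmetric])
  then have T: "partials (\<lambda>z. a (snd z) * K z) [(0, 1)] z =
     a' * K z + a (snd z) * (K z * ((norm (fst z))\<^sup>2 / (4 * (snd z - b)\<^sup>2) - real DIM('a) / (2 * (snd z - b))))"
    by (simp add: DERIV_imp_deriv del: snd_add snd_scaleR)
  have X: "partials (\<lambda>z. a (snd z) * K z) [(i, 0), (i, 0)] z
      = a (snd z) * (K z * ((fst z \<bullet> i)\<^sup>2 / (4 * (snd z - b)\<^sup>2) - 1 / (2 * (snd z - b))))"
    if i: "i \<in> Basis" for i
  proof -
    \<comment> \<open>The first derivative is computed on the whole open set \<open>S\<close>,
      because it is differentiated once more at \<open>z\<close>.\<close>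
    have 1: "partials (\<lambda>z. a (snd z) * K z) [(i, 0)] y = a (snd y) * (K y * (- (fst y \<bullet> i) / (2 * (snd y - b))))"
      if "y \<in> S" for y
    proof -
      have "((\<lambda>h. a (snd (y + h *\<^sub>R (i,0))) * K (y + h *\<^sub>R (i,0))) has_real_derivative
          a (snd y) * (K y * (- (fst y \<bullet> i) / (2 * (snd y - b))))) (at 0)"
        using dK[OF that, of "(i,0)"] by (auto intro!: derivative_eq_intros)
      then show ?thesis by (simp add: DERIV_imp_deriv del: snd_add snd_scaleR)
    qed
    have "partials (\<lambda>z. a (snd z) * K z) [(i, 0), (i, 0)] z =
       deriv (\<lambda>h. a (snd (z + h *\<^sub>R (i,0))) * (K (z + h *\<^sub>R (i,0)) *
          (- (fst (z + h *\<^sub>R (i,0)) \<bullet> i) / (2 * (snd (z + h *\<^sub>R (i,0)) - b))))) 0"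
      by (subst partials.simps(2), rule line_deriv_cong[OF S 1])
    also have "\<dots> = a (snd z) * (K z * ((fst z \<bullet> i)\<^sup>2 / (4 * (snd z - b)\<^sup>2) - 1 / (2 * (snd z - b))))"
    proof (rule DERIV_imp_deriv)
      define q where "q = snd z - b"
      have q: "q > 0" using t by (simp add: q_def)
      have ii: "i \<bullet> i = 1" using i by simp
      have "((\<lambda>h. a (snd z) * (K (z + h *\<^sub>R (i,0)) * (- (fst z \<bullet> i + h) / (2 * q)))) has_real_derivative
          a (snd z) * (K z * (- (fst z \<bullet> i) / (2 * q)) * (- (fst z \<bullet> i) / (2 * q)) + K z * (- 1 / (2 * q)))) (at 0)"
        using dK[OF S(2), of "(i,0)"] q
        by (auto intro!: derivative_eq_intros simp: q_def[symmetric] zero_prod_def[symmetric])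
           (simp add: field_simps)
      then show "((\<lambda>h. a (snd (z + h *\<^sub>R (i,0))) * (K (z + h *\<^sub>R (i,0)) *
          (- (fst (z + h *\<^sub>R (i,0)) \<bullet> i) / (2 * (snd (z + h *\<^sub>R (i,0)) - b))))) has_real_derivative
          a (snd z) * (K z * ((fst z \<bullet> i)\<^sup>2 / (4 * (snd z - b)\<^sup>2) - 1 / (2 * (snd z - b))))) (at 0)"
        unfolding q_def[symmetric]
        by (simp add: ii inner_left_distrib q_def[symmetric] power2_eq_square algebra_simps)
    qed
    finally show ?thesis .
  qed
  have "(\<Sum>i\<in>Basis. partials (\<lambda>z. a (snd z) * K z) [(i, 0), (i, 0)] z)
     = (\<Sum>i\<in>Basis. a (snd z) * (K z * ((fst z \<bullet> i)\<^sup>2 / (4 * (snd z - b)\<^sup>2) - 1 / (2 * (snd z - b)))))"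
    by (intro sum.cong X refl)
  also have "\<dots> = a (snd z) * (K z * ((\<Sum>i\<in>Basis. (fst z \<bullet> i)\<^sup>2) / (4 * (snd z - b)\<^sup>2) - real DIM('a) / (2 * (snd z - b))))"
    by (simp add: sum_distrib_left[symmetric] sum_subtractf sum_divide_distrib)
  also have "(\<Sum>i\<in>Basis. (fst z \<bullet> i)\<^sup>2) = (norm (fst z))\<^sup>2"
    unfolding power2_norm_eq_inner euclidean_inner[of "fst z" "fst z"] by (simp add: power2_eq_square)
  finally have "heat_op (\<lambda>z. a (snd z) * K z) z = a' * K z"
    unfolding heat_op_def T by (simp del: partials.simps)
  then show ?thesis by (simp add: K_def)
qed

section \<open>Series of smooth functions\<close>

lemma partials_cmult:
  fixes f :: "'a::euclidean_space \<Rightarrow> real"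
  assumes "open S" "smooth_on S f" "bs \<in> lists Basis" "z \<in> S"
  shows "partials (\<lambda>z. c * f z) bs z = c * partials f bs z"
  using assms(3,4)
proof (induction bs arbitrary: z)
  case (Cons b bs)
  have "partials (\<lambda>z. c * f z) (b # bs) z = deriv (\<lambda>h. c * partials f bs (z + h *\<^sub>R b)) 0"
    using line_deriv_cong[OF assms(1) Cons.prems, of "partials (\<lambda>z. c * f z) bs" "\<lambda>z. c * partials f bs z"]
      Cons.IH by simp
  also have "\<dots> = c * partials f (b # bs) z"
    by (intro DERIV_imp_deriv DERIV_cmult smooth_on_has_partials[OF assms(1,2)] Cons.hyps Cons.prems)
  finally show ?case .
qed simp

lemma partials_add:
  fixes f g :: "'a::euclidean_space \<Rightarrow> real"
  assumes "open S" "smooth_on S f" "smooth_on S g" "bs \<in> lists Basis" "z \<in> S"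
  shows "partials (\<lambda>z. f z + g z) bs z = partials f bs z + partials g bs z"
  using assms(4,5)
proof (induction bs arbitrary: z)
  case (Cons b bs)
  have "partials (\<lambda>z. f z + g z) (b # bs) z = deriv (\<lambda>h. partials f bs (z + h *\<^sub>R b) + partials g bs (z + h *\<^sub>R b)) 0"
    using line_deriv_cong[OF assms(1) Cons.prems, of "partials (\<lambda>z. f z + g z) bs" "\<lambda>z. partials f bs z + partials g bs z"]
      Cons.IH by simp
  also have "\<dots> = partials f (b # bs) z + partials g (b # bs) z"
    by (intro DERIV_imp_deriv DERIV_add smooth_on_has_partials[OF assms(1,2)] smooth_on_has_partials[OF assms(1,3)]
        Cons.hyps Cons.prems)
  finally show ?case .
qed simp

lemma smooth_on_translate:
  fixes f :: "'a::euclidean_space \<Rightarrow> real"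
  assumes "open S" "smooth_on S f" "\<And>z. z \<in> T \<Longrightarrow> z - v \<in> S"
  shows "smooth_on T (\<lambda>z. f (z - v))"
proof (rule smooth_on_partialsI)
  fix bs :: "'a list" assume bs: "bs \<in> lists Basis"
  show "continuous_on T (partials (\<lambda>z. f (z - v)) bs)"
    unfolding partials_translate
    by (rule continuous_on_compose2[OF smooth_on_continuous_partials[OF assms(1,2) bs]])
       (auto intro!: continuous_intros assms(3))
  fix z b :: 'a assume "z \<in> T" "b \<in> Basis"
  then show "((\<lambda>h. partials (\<lambda>z. f (z - v)) bs (z + h *\<^sub>R b)) has_real_derivative partials (\<lambda>z. f (z - v)) (b # bs) z) (at 0)"
    using smooth_on_has_partials[OF assms(1,2) bs assms(3), of z b]
    unfolding partials_translate by (simp add: algebra_simps del: partials.simps)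
qed

text \<open>The Weierstrass test makes the series of derivatives of every order converge locally
  uniformly, which permits termwise differentiation and preserves continuity. The bound is asked of
  almost all terms only; finitely many terms do not affect convergence.\<close>

lemma
  fixes w :: "nat \<Rightarrow> 'a::euclidean_space \<Rightarrow> real"
  assumes S: "open S" and smooth: "\<And>i. smooth_on S (w i)"
    and bd: "\<And>z bs. z \<in> S \<Longrightarrow> bs \<in> lists Basis \<Longrightarrow> \<exists>e>0. ball z e \<subseteq> S \<and>
      (\<exists>M. summable M \<and> (\<forall>\<^sub>F i in sequentially. \<forall>y\<in>ball z e. \<bar>partials (w i) bs y\<bar> \<le> M i))"
  shows smooth_on_suminf: "smooth_on S (\<lambda>z. \<Sum>i. w i z)"
    and partials_suminf: "\<And>bs z. bs \<in> lists Basis \<Longrightarrow> z \<in> S \<Longrightarrow>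
      (\<lambda>i. partials (w i) bs z) sums partials (\<lambda>z. \<Sum>i. w i z) bs z"
proof -
  define D where "D = (\<lambda>bs z. \<Sum>i. partials (w i) bs z)"
  have unif: "\<exists>e>0. ball z e \<subseteq> S \<and>
      uniform_limit (ball z e) (\<lambda>n y. \<Sum>i<n. partials (w i) bs y) (D bs) sequentially"
    if zb: "z \<in> S" "bs \<in> lists Basis" for z bs
  proof -
    obtain e M where e: "e > 0" "ball z e \<subseteq> S" and M: "summable M"
      "\<forall>\<^sub>F i in sequentially. \<forall>y\<in>ball z e. norm (partials (w i) bs y) \<le> M i"
      using bd[OF zb] by auto
    from Weierstrass_m_test_ev[OF M(2,1)] e show ?thesis unfolding D_def by blast
  qed
  have sm: "(\<lambda>i. partials (w i) bs z) sums D bs z" if zb: "z \<in> S" "bs \<in> lists Basis" for z bs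
  proof -
    obtain e where e: "e > 0"
      "uniform_limit (ball z e) (\<lambda>n y. \<Sum>i<n. partials (w i) bs y) (D bs) sequentially"
      using unif[OF zb] by blast
    then show ?thesis unfolding sums_def
      using tendsto_uniform_limitI[OF e(2)] by simp
  qed
  have der: "((\<lambda>h. D bs (z + h *\<^sub>R b)) has_real_derivative D (b # bs) z) (at 0)"
    if z: "z \<in> S" and bs: "bs \<in> lists Basis" and b: "b \<in> Basis" for z b bs
  proof -
    obtain e where e: "e > 0" "ball z e \<subseteq> S"
      "uniform_limit (ball z e) (\<lambda>n y. \<Sum>i<n. partials (w i) (b # bs) y) (D (b # bs)) sequentially"
      using unif[OF z, of "b # bs"] bs b by auto
    \<comment> \<open>A basis vector has norm 1, so the segment of parameters
      \<open>ball 0 e\<close> maps into \<open>ball z e\<close>, and the theorem on series of one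
      real variable applies along the line.\<close>
    have in_ball: "z + h *\<^sub>R b \<in> ball z e" if "h \<in> ball 0 e" for h
      using that b by (simp add: dist_norm)
    have "((\<lambda>h. \<Sum>i. partials (w i) bs (z + h *\<^sub>R b)) has_field_derivative
        (\<Sum>i. partials (w i) (b # bs) (z + 0 *\<^sub>R b))) (at 0)"
    proof (rule has_field_derivative_series'(2)[where S = "ball 0 e" and x0 = 0])
      fix i h assume h: "h \<in> ball (0::real) e"
      have "((\<lambda>k. partials (w i) bs ((z + h *\<^sub>R b) + k *\<^sub>R b)) has_real_derivative partials (w i) (b # bs) (z + h *\<^sub>R b)) (at 0)"
        using smooth_on_has_partials[OF S smooth bs] in_ball[OF h] e(2) b by blast
      then have "((\<lambda>k. partials (w i) bs (z + (k + h) *\<^sub>R b)) has_real_derivative partials (w i) (b # bs) (z + h *\<^sub>R b)) (at 0)"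
        by (simp add: algebra_simps del: partials.simps)
      then have "((\<lambda>h. partials (w i) bs (z + h *\<^sub>R b)) has_real_derivative partials (w i) (b # bs) (z + h *\<^sub>R b)) (at (0 + h))"
        by (subst DERIV_shift)
      then show "((\<lambda>h. partials (w i) bs (z + h *\<^sub>R b)) has_real_derivative partials (w i) (b # bs) (z + h *\<^sub>R b)) (at h within ball 0 e)"
        by (simp add: has_field_derivative_at_within del: partials.simps)
    next
      show "uniformly_convergent_on (ball 0 e) (\<lambda>n h. \<Sum>i<n. partials (w i) (b # bs) (z + h *\<^sub>R b))"
        unfolding uniformly_convergent_on_def
        using uniform_limit_compose'[OF e(3), of "\<lambda>h. z + h *\<^sub>R b" "ball 0 e"] in_ball by blast
      show "summable (\<lambda>n. partials (w n) bs (z + 0 *\<^sub>R b))"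
        using sm[OF z bs] by (simp add: sums_iff)
    qed (use e(1) in auto)
    then show ?thesis by (simp add: D_def del: partials.simps)
  qed
  have cont: "continuous_on S (D bs)" if bs: "bs \<in> lists Basis" for bs
    unfolding continuous_on_eq_continuous_at[OF S]
  proof
    fix z assume "z \<in> S"
    then obtain e where e: "e > 0" "ball z e \<subseteq> S"
      "uniform_limit (ball z e) (\<lambda>n y. \<Sum>i<n. partials (w i) bs y) (D bs) sequentially"
      using unif bs by blast
    have "continuous_on (ball z e) (D bs)"
    proof (rule uniform_limit_theorem[OF _ e(3)])
      show "\<forall>\<^sub>F n in sequentially. continuous_on (ball z e) (\<lambda>y. \<Sum>i<n. partials (w i) bs y)"
        using continuous_on_subset[OF smooth_on_continuous_partials[OF S smooth bs] e(2)]
        by (intro always_eventually allI continuous_on_sum) auto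
    qed auto
    then show "isCont (D bs) z"
      using e(1) by (simp add: continuous_on_eq_continuous_at)
  qed
  have D_Nil: "D [] z = (\<Sum>i. w i z)" for z
    by (simp add: D_def)
  show "smooth_on S (\<lambda>z. \<Sum>i. w i z)"
    unfolding smooth_on_def
    \<comment> \<open>The value 0 on lists with entries outside \<open>Basis\<close> again satisfies
      the clauses for all lists.\<close>
    by (rule exI[of _ "\<lambda>bs. if bs \<in> lists Basis then D bs else (\<lambda>_. 0)"])
       (use der cont in \<open>auto simp del: partials.simps simp: D_Nil\<close>)
  fix bs :: "'a list" and z assume bs: "bs \<in> lists Basis" and z: "z \<in> S"
  have "partials (\<lambda>z. \<Sum>i. w i z) bs z = D bs z"
    using bs z
  proof (induction bs arbitrary: z)
    case Nil
    then show ?case by (simp add: D_def)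
  next
    case (Cons b bs)
    have "partials (\<lambda>z. \<Sum>i. w i z) (b # bs) z = deriv (\<lambda>h. D bs (z + h *\<^sub>R b)) 0"
      using line_deriv_cong[OF S Cons.prems, of "partials (\<lambda>z. \<Sum>i. w i z) bs" "D bs"] Cons.IH by simp
    also have "\<dots> = D (b # bs) z"
      by (intro DERIV_imp_deriv der Cons.prems Cons.hyps)
    finally show ?case .
  qed
  then show "(\<lambda>i. partials (w i) bs z) sums partials (\<lambda>z. \<Sum>i. w i z) bs z"
    using sm[OF z bs] by simp
qed

section \<open>Pulses\<close>

text \<open>The kernel is centred at time \<open>s - \<tau>\<close>, a full width before the step
  leaves 0. Where the pulse is nonzero the kernel is thus older than \<open>\<tau>\<close>, and its
  singularity is never met.\<close>

definition pulse :: "real \<Rightarrow> real \<Rightarrow> 'a::euclidean_space \<times> real \<Rightarrow> real" where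
  "pulse s \<tau> z = step ((snd z - s) / \<tau>) * heat_kernel (fst z) (snd z - (s - \<tau>))"

lemma pulse_nonneg: "pulse s \<tau> z \<ge> 0"
  by (simp add: pulse_def step_nonneg heat_kernel_nonneg)

lemma pulse_le: "pulse s \<tau> z \<le> heat_kernel (fst z) (snd z - (s - \<tau>))"
  using mult_right_mono[OF step_le_1 heat_kernel_nonneg] by (simp add: pulse_def)

lemma pulse_before: "\<tau> > 0 \<Longrightarrow> snd z \<le> s \<Longrightarrow> pulse s \<tau> z = 0"
  by (simp add: pulse_def step_eq_0 divide_le_0_iff)

lemma pulse_after: "\<tau> > 0 \<Longrightarrow> snd z \<ge> s + \<tau> \<Longrightarrow> pulse s \<tau> z = heat_kernel (fst z) (snd z - (s - \<tau>))"
  by (simp add: pulse_def step_eq_1 le_divide_eq_1)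

text \<open>Before time \<open>s\<close> the pulse vanishes, and after time
  \<open>s - \<tau>\<close> it is a product of smooth functions; these two open sets overlap and
  cover space-time.\<close>

lemma smooth_on_pulse:
  assumes "\<tau> > 0"
  shows "smooth_on UNIV (pulse s \<tau> :: 'a::euclidean_space \<times> real \<Rightarrow> real)"
proof (rule smooth_on_locally)
  fix z :: "'a \<times> real"
  show "\<exists>U. open U \<and> z \<in> U \<and> smooth_on U (pulse s \<tau>)"
  proof (cases "snd z < s")
    case True
    have "smooth_on (UNIV \<times> {..<s}) (pulse s \<tau> :: 'a \<times> real \<Rightarrow> real)"
      by (rule smooth_on_cong[OF _ smooth_on_const[of _ 0]])
         (use assms in \<open>auto simp: mem_Times_iff intro: pulse_before\<close>)
    then show ?thesis using True
      by (intro exI[of _ "UNIV \<times> {..<s}"]) (auto simp: mem_Times_iff intro: open_Times)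
  next
    case False
    have "smooth_on (UNIV \<times> {s-\<tau><..}) (\<lambda>z::'a \<times> real. step ((snd z - s) / \<tau>) * heat_fun (z - (0, s - \<tau>)))"
    proof (rule smooth_on_mult)
      show "smooth_on (UNIV \<times> {s-\<tau><..}) (\<lambda>z::'a \<times> real. step ((snd z - s) / \<tau>))"
        by (rule smooth_on_subset[OF smooth_on_step]) (use assms in auto)
      show "smooth_on (UNIV \<times> {s-\<tau><..}) (\<lambda>z::'a \<times> real. heat_fun (z - (0, s - \<tau>)))"
        by (rule smooth_on_translate[OF _ smooth_on_heat_fun, where v = "(0, s - \<tau>)"])
           (auto intro: open_Times)
    qed
    then have "smooth_on (UNIV \<times> {s-\<tau><..}) (pulse s \<tau> :: 'a \<times> real \<Rightarrow> real)"
      by (rule smooth_on_cong[rotated]) (simp add: pulse_def)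
    then show ?thesis using False assms
      by (intro exI[of _ "UNIV \<times> {s-\<tau><..}"]) (auto simp: mem_Times_iff intro: open_Times)
  qed
qed

lemma heat_op_pulse:
  assumes "\<tau> > 0"
  shows "heat_op (pulse s \<tau>) z = step' ((snd z - s) / \<tau>) / \<tau> * heat_kernel (fst z) (snd z - (s - \<tau>))"
proof (cases "snd z < s")
  case True
  \<comment> \<open>The zero function is written as a kernel with amplitude 0, centred one time unit
    before \<open>z\<close>, so that the formula for modulated kernels is applicable at
    \<open>z\<close>.\<close>
  have "heat_op (pulse s \<tau>) z = heat_op (\<lambda>y. 0 * heat_kernel (fst y) (snd y - (snd z - 1))) z"
    by (rule heat_op_cong[of "UNIV \<times> {..<s}"])
       (use assms True in \<open>auto simp: mem_Times_iff intro: pulse_before open_Times\<close>)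
  then have "heat_op (pulse s \<tau>) z = 0"
    using heat_op_modulated_kernel[of "snd z - 1" z "\<lambda>_. 0" 0] by simp
  moreover have "step' ((snd z - s) / \<tau>) = 0"
    using True assms by (intro step'_eq_0) (simp add: divide_le_0_iff)
  ultimately show ?thesis by simp
next
  case False
  have "((\<lambda>t. step ((t - s) / \<tau>)) has_real_derivative step' ((snd z - s) / \<tau>) * (1 / \<tau>)) (at (snd z))"
    by (rule DERIV_chain2[OF step_has_derivative]) (use assms in \<open>auto intro!: derivative_eq_intros\<close>)
  from heat_op_modulated_kernel[OF _ this, of "s - \<tau>"] False assms
  show ?thesis by (simp add: pulse_def[abs_def])
qed

text \<open>\<open>eventually_past\<close> says that at any positive time almost all pulses of
  positive mass are fully switched on, so that the tail of the series consists of shifted heat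
  kernels. \<open>start_nonneg\<close> keeps the centres of these kernels in nonnegative
  time.\<close>

locale pulse_train =
  fixes m s \<tau> :: "nat \<Rightarrow> real"
  assumes m_nonneg: "\<And>i. 0 \<le> m i"
    and summable_m: "summable m"
    and \<tau>_pos: "\<And>i. 0 < \<tau> i"
    and start_nonneg: "\<And>i. 0 \<le> s i - \<tau> i"
    and eventually_past: "\<And>\<delta>. 0 < \<delta> \<Longrightarrow> \<forall>\<^sub>F i in sequentially. m i = 0 \<or> s i + \<tau> i \<le> \<delta>"
begin

definition term_fun :: "nat \<Rightarrow> 'a::euclidean_space \<times> real \<Rightarrow> real" where
  "term_fun i z = m i * pulse (s i) (\<tau> i) z"

definition train :: "'a::euclidean_space \<times> real \<Rightarrow> real" where
  "train z = heat_fun z + (\<Sum>i. term_fun i z)"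

text \<open>The image of the \<open>i\<close>-th term under the heat operator, as
  \<open>heat_op_term\<close> confirms.\<close>

definition source :: "nat \<Rightarrow> 'a::euclidean_space \<times> real \<Rightarrow> real" where
  "source i z = m i * (step' ((snd z - s i) / \<tau> i) / \<tau> i * heat_kernel (fst z) (snd z - (s i - \<tau> i)))"

lemma term_fun_nonneg: "term_fun i z \<ge> 0"
  by (simp add: term_fun_def m_nonneg pulse_nonneg)

lemma smooth_on_term: "smooth_on UNIV (term_fun i :: 'a::euclidean_space \<times> real \<Rightarrow> real)"
  unfolding term_fun_def [abs_def]
  by (intro smooth_on_mult smooth_on_const smooth_on_pulse \<tau>_pos)

text \<open>Near a point at time \<open>t\<close>, almost every term of positive mass is
  \<open>m i\<close> times the heat kernel delayed by some \<open>b\<close> in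
  \<open>[0, t / 2]\<close>. Its derivatives there are \<open>m i\<close> times values of
  derivatives of the kernel on one compact set, so \<open>m i * C\<close> is a summable
  majorant.\<close>

lemma term_fun_bound:
  fixes z :: "'a::euclidean_space \<times> real"
  assumes z: "z \<in> UNIV \<times> {0<..}" and bs: "bs \<in> lists Basis"
  shows "\<exists>e>0. ball z e \<subseteq> UNIV \<times> {0<..} \<and>
      (\<exists>M. summable M \<and> (\<forall>\<^sub>F i in sequentially. \<forall>y\<in>ball z e. \<bar>partials (term_fun i) bs y\<bar> \<le> M i))"
proof -
  obtain x t where zx: "z = (x, t)" "t > 0" using z by auto
  define e where "e = t / 4"
  have e: "e > 0" using zx by (simp add: e_def)
  \<comment> \<open>The ball has times above \<open>3 * t / 4\<close> since
    \<open>e = t / 4\<close>; a delay of at most \<open>t / 2\<close> leaves them above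
    \<open>t / 4\<close>.\<close>
  define K where "K = cball x e \<times> {t / 4 .. t + e}"
  have "compact K" unfolding K_def by (intro compact_Times compact_cball compact_Icc)
  moreover have "continuous_on K (partials heat_fun bs)"
    by (rule continuous_on_subset[OF smooth_on_continuous_partials[OF _ smooth_on_heat_fun bs]])
       (use zx in \<open>auto simp: K_def intro: open_Times\<close>)
  ultimately have "bounded (partials heat_fun bs ` K)"
    by (intro compact_imp_bounded compact_continuous_image)
  then obtain C where C: "\<And>y. y \<in> K \<Longrightarrow> \<bar>partials heat_fun bs y\<bar> \<le> C"
    by (force simp: bounded_iff)
  have ball: "dist x (fst y) < e" "t - e < snd y" "snd y < t + e" if "y \<in> ball z e" for y
  proof -
    have "dist (fst z) (fst y) \<le> dist z y" "dist (snd z) (snd y) \<le> dist z y"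
      by (rule dist_fst_le, rule dist_snd_le)
    then show "dist x (fst y) < e" "t - e < snd y" "snd y < t + e" using that zx by (auto simp: dist_real_def)
  qed
  have "\<forall>\<^sub>F i in sequentially. \<forall>y\<in>ball z e. \<bar>partials (term_fun i) bs y\<bar> \<le> m i * C"
    using eventually_past[OF half_gt_zero[OF zx(2)]]
  proof (eventually_elim, intro ballI)
    fix i y assume i: "m i = 0 \<or> s i + \<tau> i \<le> t / 2" and y: "y \<in> ball z e"
    define S :: "('a \<times> real) set" where "S = UNIV \<times> {t / 2<..}"
    have S: "open S" "y \<in> S"
      using ball[OF y] zx by (auto simp: S_def e_def mem_Times_iff intro: open_Times)
    define b where "b = s i - \<tau> i"
    show "\<bar>partials (term_fun i) bs y\<bar> \<le> m i * C"
    proof (cases "m i = 0")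
      case True
      have "partials (term_fun i) bs y = partials (\<lambda>z. 0 * (\<lambda>_. 0) z) bs y"
        by (rule partials_cong[of UNIV]) (auto simp: term_fun_def True)
      also have "\<dots> = 0" by (subst partials_cmult[OF open_UNIV smooth_on_const bs]) auto
      finally show ?thesis using True by simp
    next
      case False
      then have si: "s i + \<tau> i \<le> t / 2" using i by simp
      have b: "0 \<le> b" "b \<le> t / 2" using start_nonneg[of i] \<tau>_pos[of i] si by (auto simp: b_def)
      have "partials (term_fun i) bs y = partials (\<lambda>z. m i * heat_fun (z - (0, b))) bs y"
      proof (rule partials_cong[OF S(1) _ S(2)])
        fix y assume "y \<in> S"
        then show "term_fun i y = m i * heat_fun (y - (0, b))"
          using si \<tau>_pos[of i] by (auto simp: term_fun_def S_def b_def pulse_after mem_Times_iff)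
      qed
      also have "\<dots> = m i * partials (\<lambda>z. heat_fun (z - (0, b))) bs y"
      proof (rule partials_cmult[OF S(1) _ bs S(2)])
        show "smooth_on S (\<lambda>z. heat_fun (z - (0, b)))"
          by (rule smooth_on_translate[OF _ smooth_on_heat_fun, where v = "(0, b)"])
             (use b in \<open>auto simp: S_def mem_Times_iff intro: open_Times\<close>)
      qed
      also have "partials (\<lambda>z. heat_fun (z - (0, b))) bs y = partials heat_fun bs (y - (0, b))"
        by (rule partials_translate)
      finally have "\<bar>partials (term_fun i) bs y\<bar> = m i * \<bar>partials heat_fun bs (y - (0, b))\<bar>"
        using m_nonneg[of i] by (simp add: abs_mult)
      moreover have "y - (0, b) \<in> K"
        using ball[OF y] b by (auto simp: K_def mem_Times_iff e_def)
      ultimately show ?thesis using C m_nonneg[of i] by (simp add: mult_left_mono)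
    qed
  qed
  moreover have "summable (\<lambda>i. m i * C)" by (intro summable_mult2 summable_m)
  moreover have "ball z e \<subseteq> UNIV \<times> {0<..}"
    using ball zx by (fastforce simp: mem_Times_iff e_def)
  ultimately show ?thesis using e by blast
qed

lemma open_half: "open ((UNIV :: 'a::euclidean_space set) \<times> {0::real<..})"
  by (intro open_Times) auto

lemma smooth_on_term': "smooth_on (UNIV \<times> {0<..}) (term_fun i :: 'a::euclidean_space \<times> real \<Rightarrow> real)"
  by (rule smooth_on_subset[OF smooth_on_term]) auto

lemmas smooth_on_term_sum = smooth_on_suminf[OF open_half smooth_on_term' term_fun_bound]
lemmas partials_term_sum = partials_suminf[OF open_half smooth_on_term' term_fun_bound]

lemma smooth_on_train: "smooth_on (UNIV \<times> {0<..}) (train :: 'a::euclidean_space \<times> real \<Rightarrow> real)"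
  unfolding train_def [abs_def] by (intro smooth_on_add smooth_on_heat_fun smooth_on_term_sum)

lemma summable_term: 
  fixes z :: "'a::euclidean_space \<times> real" 
  assumes "snd z > 0"
  shows "summable (\<lambda>i. term_fun i z)"
  using partials_term_sum[of "[]" z] assms by (auto simp: sums_iff mem_Times_iff)

lemma train_ge_heat: "snd z > 0 \<Longrightarrow> heat_fun z \<le> train z"
  using suminf_nonneg[OF summable_term term_fun_nonneg] by (simp add: train_def)

lemma train_ge_term:
  assumes "snd z > 0"
  shows "term_fun i z \<le> train z"
proof -
  have "sum (\<lambda>i. term_fun i z) {i} \<le> (\<Sum>i. term_fun i z)"
    by (rule sum_le_suminf[OF summable_term]) (auto simp: assms term_fun_nonneg)
  then show ?thesis using heat_kernel_nonneg[of "fst z" "snd z"] by (simp add: train_def)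
qed

lemma train_pos: "snd z > 0 \<Longrightarrow> train z > 0"
  using train_ge_heat heat_kernel_pos less_le_trans by blast

lemma heat_op_lists:
  "[(0::'a::euclidean_space, 1::real)] \<in> lists Basis"
  "i \<in> Basis \<Longrightarrow> [(i, 0), (i, 0)] \<in> lists (Basis :: ('a::euclidean_space \<times> real) set)"
  by (auto simp: Basis_prod_def)

lemma heat_op_lincomb:
  fixes z :: "'a::euclidean_space \<times> real"
  assumes "\<And>bs. bs \<in> lists Basis \<Longrightarrow> partials f bs z = c * partials g bs z + d * partials h bs z"
  shows "heat_op f z = c * heat_op g z + d * heat_op h z"
proof -
  have 1: "partials f [(0, 1)] z = c * partials g [(0, 1)] z + d * partials h [(0, 1)] z"
    by (rule assms[OF heat_op_lists(1)])
  have 2: "(\<Sum>i\<in>Basis. partials f [(i, 0), (i, 0)] z) =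
      (\<Sum>i\<in>Basis. c * partials g [(i, 0), (i, 0)] z + d * partials h [(i, 0), (i, 0)] z)"
    by (intro sum.cong refl assms heat_op_lists(2))
  show ?thesis
    unfolding heat_op_def 1 2 by (simp add: sum.distrib sum_distrib_left algebra_simps del: partials.simps)
qed

lemma heat_op_term: "heat_op (term_fun i) z = source i z"
proof -
  have "heat_op (term_fun i) z = m i * heat_op (pulse (s i) (\<tau> i)) z"
    unfolding term_fun_def [abs_def]
    using heat_op_lincomb[of "\<lambda>z. m i * pulse (s i) (\<tau> i) z" z "m i" "pulse (s i) (\<tau> i)" 0 "pulse (s i) (\<tau> i)"]
      partials_cmult[OF open_UNIV smooth_on_pulse[OF \<tau>_pos], of _ z "m i" "s i" i] by simp
  then show ?thesis by (simp add: heat_op_pulse[OF \<tau>_pos] source_def)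
qed

lemma heat_op_heat_fun:
  fixes z :: "'a::euclidean_space \<times> real" 
  assumes "snd z > 0" shows "heat_op heat_fun z = 0"
  using heat_op_modulated_kernel[of 0 z "\<lambda>_. 1" 0] assms by simp

text \<open>The leading heat kernel is annihilated by the heat operator and the series is
  differentiated termwise, so only the sources remain.\<close>

lemma heat_op_train_sums:
  fixes z :: "'a::euclidean_space \<times> real" 
  assumes "snd z > 0"
  shows "(\<lambda>i. source i z) sums heat_op train z"
proof -
  have z: "z \<in> UNIV \<times> {0<..}" using assms by (auto simp: mem_Times_iff)
  have "partials train bs z = partials heat_fun bs z + partials (\<lambda>z. \<Sum>i. term_fun i z) bs z" if "bs \<in> lists Basis" for bs
    unfolding train_def [abs_def]
    by (rule partials_add[OF open_half smooth_on_heat_fun smooth_on_term_sum that z])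
  then have "heat_op train z = heat_op heat_fun z + heat_op (\<lambda>z. \<Sum>i. term_fun i z) z"
    using heat_op_lincomb[of train z 1 heat_fun 1 "\<lambda>z. \<Sum>i. term_fun i z"] by simp
  also have "\<dots> = heat_op (\<lambda>z. \<Sum>i. term_fun i z) z"
    using assms by (simp add: heat_op_heat_fun)
  finally have "heat_op train z = heat_op (\<lambda>z. \<Sum>i. term_fun i z) z" .
  moreover have "(\<lambda>i. heat_op (term_fun i) z) sums heat_op (\<lambda>z. \<Sum>i. term_fun i z) z"
    unfolding heat_op_def
    by (intro sums_diff sums_sum partials_term_sum heat_op_lists z)
  ultimately show ?thesis by (simp add: heat_op_term)
qed

lemma source_nonneg: "source i z \<ge> 0"
  using \<tau>_pos[of i] by (simp add: source_def m_nonneg step'_nonneg heat_kernel_nonneg)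

end

section \<open>Integrability\<close>

lemma nn_integral_gaussian_real:
  assumes "a > (0::real)"
  shows "(\<integral>\<^sup>+y. ennreal (exp (- a * y\<^sup>2)) \<partial>lborel) = ennreal (sqrt (pi / a))"
proof -
  \<comment> \<open>With variance \<open>1 / (2 * a)\<close> the integrand is
    \<open>sqrt (pi / a)\<close> times a normal density.\<close>
  define \<sigma> where "\<sigma> = sqrt (1 / (2 * a))"
  have \<sigma>: "\<sigma> > 0" "\<sigma>\<^sup>2 = 1 / (2 * a)" using assms by (auto simp: \<sigma>_def)
  have "(\<integral>\<^sup>+y. ennreal (exp (- a * y\<^sup>2)) \<partial>lborel)
     = (\<integral>\<^sup>+y. ennreal (sqrt (pi / a)) * ennreal (normal_density 0 \<sigma> y) \<partial>lborel)"
  proof (rule nn_integral_cong)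
    fix y :: real
    have "exp (- a * y\<^sup>2) = sqrt (pi / a) * normal_density 0 \<sigma> y"
      unfolding normal_density_def \<sigma>(2) using assms by (simp add: field_simps)
    then show "ennreal (exp (- a * y\<^sup>2)) = ennreal (sqrt (pi / a)) * ennreal (normal_density 0 \<sigma> y)"
      using assms by (simp add: ennreal_mult)
  qed
  also have "\<dots> = ennreal (sqrt (pi / a)) * (\<integral>\<^sup>+y. ennreal (normal_density 0 \<sigma> y) \<partial>lborel)"
    by (rule nn_integral_cmult) simp
  also have "(\<integral>\<^sup>+y. ennreal (normal_density 0 \<sigma> y) \<partial>lborel) = 1"
    using \<sigma> by (subst nn_integral_eq_integral) auto
  finally show ?thesis by simp
qed

text \<open>The Gaussian of the norm is the product of the Gaussians of the coordinates, so the
  integral factors.\<close>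

lemma nn_integral_gaussian:
  assumes "a > (0::real)"
  shows "(\<integral>\<^sup>+y. ennreal (exp (- a * (norm (y::'a::euclidean_space))\<^sup>2)) \<partial>lborel) = ennreal (sqrt (pi / a) ^ DIM('a))"
proof -
  have "exp (- a * (norm y)\<^sup>2) = (\<Prod>b\<in>Basis. exp (- a * (y \<bullet> b)\<^sup>2))" for y :: 'a
  proof -
    have "(norm y)\<^sup>2 = (\<Sum>b\<in>Basis. (y \<bullet> b)\<^sup>2)"
      unfolding power2_norm_eq_inner euclidean_inner[of y y] by (simp add: power2_eq_square)
    then show ?thesis by (simp add: exp_sum[symmetric] sum_distrib_left sum_negf)
  qed
  then have "(\<integral>\<^sup>+y. ennreal (exp (- a * (norm (y::'a))\<^sup>2)) \<partial>lborel)
      = (\<integral>\<^sup>+y. (\<Prod>b\<in>Basis. ennreal (exp (- a * ((y::'a) \<bullet> b)\<^sup>2))) \<partial>lborel)"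
    by (simp add: prod_ennreal)
  also have "\<dots> = (\<Prod>b\<in>(Basis::'a set). \<integral>\<^sup>+y. ennreal (exp (- a * y\<^sup>2)) \<partial>lborel)"
    by (rule nn_integral_lborel_prod) auto
  also have "\<dots> = ennreal (sqrt (pi / a) ^ DIM('a))"
    unfolding nn_integral_gaussian_real[OF assms] using assms by (simp add: ennreal_power)
  finally show ?thesis .
qed

lemma heat_kernel_powr:
  assumes "t > 0"
  shows "heat_kernel (x::'a::euclidean_space) t powr q
    = (4 * pi * t) powr (- real DIM('a) * q / 2) * exp (- (q / (4 * t)) * (norm x)\<^sup>2)"
proof -
  have "exp (- (norm x)\<^sup>2 / (4 * t)) powr q = exp (- (q / (4 * t)) * (norm x)\<^sup>2)"
    by (simp add: powr_def)
  then show ?thesis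
    using assms by (simp add: heat_kernel_def powr_mult powr_powr)
qed

text \<open>A power of the kernel is again a Gaussian: its prefactor contributes \<open>t\<close> to
  the power \<open>- n * lam / 2\<close>, and integration over a width of order
  \<open>sqrt t\<close> contributes \<open>t\<close> to the power \<open>n / 2\<close>.\<close>

lemma nn_integral_heat_kernel_powr:
  assumes "lam > 0"
  obtains C where "C > 0" "\<And>t. t > 0 \<Longrightarrow> (\<integral>\<^sup>+x. ennreal (heat_kernel (x::'a::euclidean_space) t powr lam) \<partial>lborel)
    = ennreal (C * t powr (real DIM('a) * (1 - lam) / 2))"
proof
  define n where "n = real DIM('a)"
  define C where "C = (4 * pi) powr (- n * lam / 2) * (4 * pi / lam) powr (n / 2)"
  show "C > 0" using assms by (simp add: C_def)
  fix t :: real assume t: "t > 0"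
  define a where "a = lam / (4 * t)"
  have a: "a > 0" using assms t by (simp add: a_def)
  have "(\<integral>\<^sup>+x. ennreal (heat_kernel (x::'a) t powr lam) \<partial>lborel)
     = (\<integral>\<^sup>+x. ennreal ((4 * pi * t) powr (- n * lam / 2)) * ennreal (exp (- a * (norm (x::'a))\<^sup>2)) \<partial>lborel)"
    by (simp add: heat_kernel_powr[OF t] n_def a_def ennreal_mult)
  also have "\<dots> = ennreal ((4 * pi * t) powr (- n * lam / 2)) * ennreal (sqrt (pi / a) ^ DIM('a))"
    by (subst nn_integral_cmult) (auto simp: nn_integral_gaussian[OF a, where ?'a = 'a, simplified])
  also have "\<dots> = ennreal ((4 * pi * t) powr (- n * lam / 2) * sqrt (pi / a) ^ DIM('a))"
    using a by (subst ennreal_mult) auto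
  also have "sqrt (pi / a) ^ DIM('a) = (pi / a) powr (n / 2)"
    using a by (simp add: powr_half_sqrt[symmetric] powr_realpow[symmetric] powr_powr n_def)
  also have "(pi / a) powr (n / 2) = (4 * pi / lam) powr (n / 2) * t powr (n / 2)"
    using t assms by (simp add: a_def powr_mult[symmetric] field_simps)
  also have "(4 * pi * t) powr (- n * lam / 2) = (4 * pi) powr (- n * lam / 2) * t powr (- n * lam / 2)"
    using t by (simp add: powr_mult)
  also have "(4 * pi) powr (- n * lam / 2) * t powr (- n * lam / 2) * ((4 * pi / lam) powr (n / 2) * t powr (n / 2))
     = C * t powr (n * (1 - lam) / 2)"
  proof -
    have "t powr (n * (1 - lam) / 2) = t powr (- n * lam / 2) * t powr (n / 2)"
      by (simp add: powr_add[symmetric] field_simps)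
    then show ?thesis by (simp add: C_def)
  qed
  finally show "(\<integral>\<^sup>+x. ennreal (heat_kernel (x::'a) t powr lam) \<partial>lborel)
    = ennreal (C * t powr (real DIM('a) * (1 - lam) / 2))" by (simp add: n_def)
qed

lemma measurable_heat_kernel [measurable]:
  "(\<lambda>z::'a::euclidean_space \<times> real. heat_kernel (fst z) (snd z - b)) \<in> borel_measurable borel"
  unfolding heat_kernel_def borel_prod[symmetric] by measurable

text \<open>The upper bound on \<open>lam\<close> says precisely that the exponent \<open>p\<close>
  of the spatial integrals exceeds -1, so they are integrable at time 0. The constant is uniform in
  \<open>b\<close>, so it serves all pulses at once.\<close>

lemma nn_integral_heat_kernel_powr_strip:
  assumes "lam > 0" "lam < (real DIM('a) + 2) / real DIM('a)"
  obtains C where "C \<ge> 0" "\<And>b. b \<ge> 0 \<Longrightarrow> (\<integral>\<^sup>+z\<in>UNIV \<times> {0<..<1}.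
      ennreal (heat_kernel (fst z :: 'a::euclidean_space) (snd z - b) powr lam) \<partial>lborel) \<le> ennreal C"
proof -
  define p where "p = real DIM('a) * (1 - lam) / 2"
  have p: "p > -1" using assms by (simp add: p_def field_simps)
  obtain C where C: "C > 0" "\<And>t. t > 0 \<Longrightarrow> (\<integral>\<^sup>+x. ennreal (heat_kernel (x::'a) t powr lam) \<partial>lborel)
    = ennreal (C * t powr p)"
    using nn_integral_heat_kernel_powr[OF assms(1), where ?'a = 'a] unfolding p_def by blast
  have P: "(\<integral>\<^sup>+t. ennreal (C * t powr p) * indicator {0..1} t \<partial>lborel) = ennreal (C / (p + 1))"
  proof -
    have "(\<integral>\<^sup>+t. ennreal (C * t powr p) * indicator {0..1} t \<partial>lborel)
       = (\<integral>\<^sup>+t. ennreal (if t \<in> {0..1} then C * t powr p else 0) \<partial>lborel)"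
      by (intro nn_integral_cong) (auto simp: indicator_def)
    also have "\<dots> = ennreal (C * (1 powr (p + 1) / (p + 1)))"
    proof (rule nn_integral_has_integral_lborel)
      show "((\<lambda>t. if t \<in> {0..1} then C * t powr p else 0) has_integral C * (1 powr (p + 1) / (p + 1))) UNIV"
        unfolding has_integral_restrict_UNIV
        by (intro has_integral_mult_right has_integral_powr_from_0 p) simp
    qed (use C(1) in auto)
    finally show ?thesis by simp
  qed
  have "(\<integral>\<^sup>+z\<in>UNIV \<times> {0<..<1}. ennreal (heat_kernel (fst z :: 'a) (snd z - b) powr lam) \<partial>lborel)
      \<le> ennreal (C / (p + 1))" if "b \<ge> 0" for b
  proof -
    have "(\<integral>\<^sup>+z\<in>UNIV \<times> {0<..<1}. ennreal (heat_kernel (fst z :: 'a) (snd z - b) powr lam) \<partial>lborel)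
      = (\<integral>\<^sup>+t. (\<integral>\<^sup>+x. ennreal (heat_kernel (x :: 'a) (t - b) powr lam) * indicator {0<..<1} t \<partial>lborel) \<partial>lborel)"
    proof -
      have [measurable]: "(UNIV :: 'a set) \<times> {0::real<..<1} \<in> sets borel"
        by (intro borel_open open_Times) auto
      have "(\<lambda>z::'a \<times> real. ennreal (heat_kernel (fst z) (snd z - b) powr lam) * indicator (UNIV \<times> {0<..<1}) z)
          \<in> borel_measurable borel"
        by measurable
      then show ?thesis
        unfolding lborel_prod[symmetric]
        by (subst lborel_pair.nn_integral_snd[symmetric])
           (auto simp: lborel_prod indicator_def intro!: nn_integral_cong)
    qed
    \<comment> \<open>For \<open>t \<le> b\<close> the kernel vanishes, and otherwise
      \<open>t - b\<close> lies in the unit interval because \<open>b\<close> is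
      nonnegative.\<close>
    also have "\<dots> \<le> (\<integral>\<^sup>+t. ennreal (C * (t - b) powr p) * indicator {0..1} (t - b) \<partial>lborel)"
    proof (rule nn_integral_mono)
      fix t :: real
      show "(\<integral>\<^sup>+x. ennreal (heat_kernel (x :: 'a) (t - b) powr lam) * indicator {0<..<1} t \<partial>lborel)
         \<le> ennreal (C * (t - b) powr p) * indicator {0..1} (t - b)"
        using that C(2)[of "t - b"]
        by (cases "b < t") (auto simp: indicator_def heat_kernel_def[of _ "t - b"])
    qed
    also have "\<dots> = (\<integral>\<^sup>+t. ennreal (C * t powr p) * indicator {0..1} t \<partial>lborel)"
      using nn_integral_real_affine[of "\<lambda>t. ennreal (C * t powr p) * indicator {0..1} t" 1 "- b"] by simp
    finally show ?thesis unfolding P .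
  qed
  then show ?thesis using that[of "C / (p + 1)"] C(1) p by auto
qed

section \<open>The \<open>L^lam\<close> bound for the superposition\<close>

context pulse_train
begin

text \<open>Splitting \<open>m i = sqrt (m i) * sqrt (m i)\<close> and bounding one factor times the kernel by
  the supremum over \<open>i\<close> treats \<open>lam \<le> 1\<close> and \<open>lam > 1\<close> alike.\<close>

lemma train_powr_le:
  fixes z :: "'a::euclidean_space \<times> real"
  assumes lam: "lam > 0" and t: "snd z > 0" and S: "summable (\<lambda>i. sqrt (m i))"
  shows "ennreal (train z powr lam) \<le> ennreal ((1 + (\<Sum>i. sqrt (m i))) powr lam) *
    (ennreal (heat_fun z powr lam) +
     (\<Sum>i. ennreal (m i powr (lam / 2)) * ennreal (heat_kernel (fst z) (snd z - (s i - \<tau> i)) powr lam)))"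
    (is "_ \<le> _ * (_ + suminf ?f)")
proof -
  define \<Sigma> where "\<Sigma> = (\<Sum>i. sqrt (m i))"
  have \<Sigma>: "\<Sigma> \<ge> 0" unfolding \<Sigma>_def by (rule suminf_nonneg[OF S]) (simp add: m_nonneg)
  show ?thesis
  proof (cases "ennreal (heat_fun z powr lam) + suminf ?f")
    case top
    then show ?thesis using \<Sigma> by (simp add: \<Sigma>_def[symmetric] ennreal_mult_top)
  next
    case (real q)
    \<comment> \<open>Each summand is at most the whole sum \<open>q\<close>, so the
      \<open>lam\<close>-th root of each is at most \<open>Q\<close>. This bounds the heat kernel
      and all products \<open>sqrt (m i)\<close> times kernel by one number.\<close>
    define Q where "Q = q powr (1 / lam)"
    have Qq: "Q powr lam = q" using lam real by (simp add: Q_def powr_powr)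
    have root: "a \<le> Q" if "a \<ge> 0" "a powr lam \<le> q" for a
    proof -
      have "(a powr lam) powr (1 / lam) \<le> Q"
        unfolding Q_def using that lam by (intro powr_mono2) auto
      then show ?thesis using lam that by (simp add: powr_powr)
    qed
    have "ennreal (heat_fun z powr lam) \<le> ennreal q"
      unfolding real(2)[symmetric] by simp
    then have h: "heat_fun z \<le> Q"
      using real heat_kernel_nonneg by (intro root) (auto simp: ennreal_le_iff)
    have "?f i \<le> ennreal q" for i
    proof -
      have "?f i \<le> suminf ?f"
        using sum_le_suminf[of ?f "{i}"] by (simp add: summableI)
      also have "\<dots> \<le> ennreal q" unfolding real(2)[symmetric] by simp
      finally show ?thesis .
    qed
    then have "m i powr (lam / 2) * heat_kernel (fst z) (snd z - (s i - \<tau> i)) powr lam \<le> q" for i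
      using real by (simp add: ennreal_mult[symmetric] ennreal_le_iff)
    moreover have "m i powr (lam / 2) * heat_kernel (fst z) (snd z - (s i - \<tau> i)) powr lam
       = (sqrt (m i) * heat_kernel (fst z) (snd z - (s i - \<tau> i))) powr lam" for i
      using m_nonneg[of i] heat_kernel_nonneg
      by (simp add: powr_mult powr_half_sqrt[symmetric] powr_powr)
    ultimately have i: "sqrt (m i) * heat_kernel (fst z) (snd z - (s i - \<tau> i)) \<le> Q" for i
      using m_nonneg[of i] heat_kernel_nonneg[of "fst z"] by (intro root) auto
    have "term_fun i z \<le> sqrt (m i) * Q" for i
    proof -
      have "term_fun i z \<le> m i * heat_kernel (fst z) (snd z - (s i - \<tau> i))"
        unfolding term_fun_def by (intro mult_left_mono pulse_le m_nonneg)
      also have "\<dots> = sqrt (m i) * (sqrt (m i) * heat_kernel (fst z) (snd z - (s i - \<tau> i)))"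
        using m_nonneg[of i] by simp
      also have "\<dots> \<le> sqrt (m i) * Q"
        using m_nonneg[of i] by (intro mult_left_mono i) auto
      finally show ?thesis .
    qed
    then have "(\<Sum>i. term_fun i z) \<le> (\<Sum>i. sqrt (m i) * Q)"
      by (intro suminf_le summable_term t summable_mult2 S)
    also have "\<dots> = \<Sigma> * Q" unfolding \<Sigma>_def by (rule suminf_mult2[OF S, symmetric])
    finally have "train z \<le> (1 + \<Sigma>) * Q" using h by (simp add: train_def algebra_simps)
    then have "train z powr lam \<le> ((1 + \<Sigma>) * Q) powr lam"
      using train_pos[OF t] lam by (intro powr_mono2) auto
    also have "\<dots> = (1 + \<Sigma>) powr lam * q"
      using \<Sigma> by (simp add: powr_mult Qq Q_def[symmetric])
    finally show ?thesis unfolding real(2) \<Sigma>_def[symmetric]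
      using real(1) by (simp add: ennreal_mult[symmetric] ennreal_le_iff)
  qed
qed

lemma continuous_on_train: "continuous_on (UNIV \<times> {0<..}) (train :: 'a::euclidean_space \<times> real \<Rightarrow> real)"
  using smooth_on_continuous_partials[OF open_half smooth_on_train, of "[]"] by simp

text \<open>The pointwise bound is integrated term by term. Every kernel, including the initial one
  with \<open>b = 0\<close>, contributes at most the same constant \<open>C\<close>, and the weights
  \<open>m i powr (lam / 2)\<close> are summable.\<close>

lemma set_integrable_train_powr:
  assumes lam: "lam > 0" "lam < (real DIM('a) + 2) / real DIM('a)"
    and S: "summable (\<lambda>i. sqrt (m i))" "summable (\<lambda>i. m i powr (lam / 2))"
  shows "set_integrable lborel (UNIV \<times> {0<..<1}) (\<lambda>z::'a::euclidean_space \<times> real. train z powr lam)"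
proof -
  define A :: "('a \<times> real) set" where "A = UNIV \<times> {0<..<1}"
  have A: "A \<in> sets borel" unfolding A_def by (intro borel_open open_Times) auto
  note [measurable] = A
  obtain C where C: "C \<ge> 0" "\<And>b. b \<ge> 0 \<Longrightarrow> (\<integral>\<^sup>+z\<in>A.
      ennreal (heat_kernel (fst z) (snd z - b) powr lam) \<partial>lborel) \<le> ennreal C"
    unfolding A_def using nn_integral_heat_kernel_powr_strip[OF lam] by blast
  have meas: "(\<lambda>z. indicator A z *\<^sub>R (train z powr lam)) \<in> borel_measurable borel"
  proof (rule borel_measurable_continuous_on_indicator[OF A])
    have "continuous_on A train" by (rule continuous_on_subset[OF continuous_on_train]) (auto simp: A_def)
    moreover have "train z \<noteq> 0" if "z \<in> A" for z
      using train_pos[of z] that by (auto simp: A_def)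
    ultimately show "continuous_on A (\<lambda>z. train z powr lam)"
      by (intro continuous_intros) auto
  qed
  define R where "R = ennreal ((1 + (\<Sum>i. sqrt (m i))) powr lam)"
  let ?g = "\<lambda>i z. ennreal (m i powr (lam / 2)) * (ennreal (heat_kernel (fst z) (snd z - (s i - \<tau> i)) powr lam) * indicator A z)"
  have "(\<integral>\<^sup>+z. ennreal (norm (indicator A z *\<^sub>R (train z powr lam))) \<partial>lborel)
     \<le> (\<integral>\<^sup>+z. R * (ennreal (heat_kernel (fst z) (snd z - 0) powr lam) * indicator A z + (\<Sum>i. ?g i z)) \<partial>lborel)"
  proof (rule nn_integral_mono)
    fix z :: "'a \<times> real"
    show "ennreal (norm (indicator A z *\<^sub>R (train z powr lam)))
       \<le> R * (ennreal (heat_kernel (fst z) (snd z - 0) powr lam) * indicator A z + (\<Sum>i. ?g i z))"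
    proof (cases "z \<in> A")
      case True
      then have "snd z > 0" by (auto simp: A_def)
      from train_powr_le[OF lam(1) this S(1)] True show ?thesis by (simp add: R_def)
    qed simp
  qed
  also have "\<dots> = R * ((\<integral>\<^sup>+z. ennreal (heat_kernel (fst z) (snd z - 0) powr lam) * indicator A z \<partial>lborel)
      + (\<Sum>i. ennreal (m i powr (lam / 2)) * (\<integral>\<^sup>+z. ennreal (heat_kernel (fst z) (snd z - (s i - \<tau> i)) powr lam) * indicator A z \<partial>lborel)))"
    by (subst nn_integral_cmult, measurable, subst nn_integral_add, measurable,
        subst nn_integral_suminf, measurable, subst nn_integral_cmult, measurable)
  also have "\<dots> \<le> R * (ennreal C + (\<Sum>i. ennreal (m i powr (lam / 2)) * ennreal C))"
    by (intro mult_left_mono add_mono suminf_le C(2) start_nonneg) (auto simp: summableI)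
  also have "(\<Sum>i. ennreal (m i powr (lam / 2)) * ennreal C) = ennreal (\<Sum>i. m i powr (lam / 2) * C)"
    using C(1) S(2) by (simp add: ennreal_mult[symmetric] suminf_ennreal2 summable_mult2)
  also have "R * (ennreal C + ennreal (\<Sum>i. m i powr (lam / 2) * C)) < \<infinity>"
    by (simp add: R_def ennreal_mult_less_top)
  finally have "integrable lborel (\<lambda>z. indicator A z *\<^sub>R (train z powr lam))"
    using meas by (intro integrableI_bounded) auto
  then show ?thesis unfolding set_integrable_def A_def .
qed

end

section \<open>The differential inequality for a single pulse\<close>

text \<open>The power factor decreases in time and the Gaussian factor increases, so each is
  evaluated at its own worst end of the interval.\<close>

lemma heat_kernel_lower:
  fixes x :: "'a::euclidean_space"
  assumes "0 < a" "a \<le> \<tau>" "\<tau> \<le> b"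
  shows "(4 * pi * b) powr (- real DIM('a) / 2) * exp (- (norm x)\<^sup>2 / (4 * a)) \<le> heat_kernel x \<tau>"
proof -
  have "(4 * pi * b) powr (- real DIM('a) / 2) \<le> (4 * pi * \<tau>) powr (- real DIM('a) / 2)"
    using assms by (intro powr_mono2') auto
  moreover have "exp (- (norm x)\<^sup>2 / (4 * a)) \<le> exp (- (norm x)\<^sup>2 / (4 * \<tau>))"
    using assms by (auto intro!: divide_left_mono)
  ultimately show ?thesis using assms by (auto simp: heat_kernel_def intro!: mult_mono)
qed

lemma heat_kernel_upper:
  fixes x :: "'a::euclidean_space"
  assumes "0 < a" "a \<le> \<tau>" "\<tau> \<le> b"
  shows "heat_kernel x \<tau> \<le> (4 * pi * a) powr (- real DIM('a) / 2) * exp (- (norm x)\<^sup>2 / (4 * b))"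
proof -
  have "(4 * pi * \<tau>) powr (- real DIM('a) / 2) \<le> (4 * pi * a) powr (- real DIM('a) / 2)"
    using assms by (intro powr_mono2') auto
  moreover have "exp (- (norm x)\<^sup>2 / (4 * \<tau>)) \<le> exp (- (norm x)\<^sup>2 / (4 * b))"
    using assms by (auto intro!: divide_left_mono)
  ultimately show ?thesis using assms by (auto simp: heat_kernel_def intro!: mult_mono)
qed

section \<open>Comparison of one source with the right-hand side\<close>

definition potential :: "real \<Rightarrow> real \<Rightarrow> ('a::euclidean_space \<times> real \<Rightarrow> real) \<Rightarrow> 'a \<Rightarrow> real \<Rightarrow> ennreal" where
  "potential \<alpha> lam u x t = (\<integral>\<^sup>+ w\<in>UNIV \<times> {0<..<1}.
     ennreal (heat_kernel (x - fst w) (t - snd w) powr (\<alpha> / real DIM('a)) * u w powr lam) \<partial>lborel)"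

text \<open>The integral is cut down to a parabolic cylinder of radius \<open>sqrt r\<close> and
  duration \<open>r / 4\<close> shortly before \<open>s\<close>. There both factors are bounded
  below by powers of \<open>r\<close> times a Gaussian in \<open>x\<close>, and the cylinder has
  volume of order \<open>r\<close> to the power \<open>1 + n / 2\<close>.\<close>

lemma potential_lower:
  fixes u :: "'a::euclidean_space \<times> real \<Rightarrow> real" and \<alpha> lam \<eta> :: real
  assumes "\<alpha> > 0" "lam > 0"
  defines "K \<equiv> (4 * pi) powr (- \<alpha> / 2) * exp (- 2 * \<alpha> / real DIM('a)) *
     ((4 * pi) powr (- real DIM('a) / 2) * exp (- 1 / 2)) powr lam * unit_ball_vol DIM('a) / 4"
  assumes r: "0 < r" "r \<le> s" and t: "s \<le> t" "t \<le> s + r / 2" "t < 1"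
    and u: "\<And>y q. s - r / 2 \<le> q \<Longrightarrow> q \<le> s \<Longrightarrow> r powr \<eta> * heat_kernel y (q - s + r) \<le> u (y, q)"
  shows "ennreal (K * r powr (1 + real DIM('a) / 2 - \<alpha> / 2 + (\<eta> - real DIM('a) / 2) * lam) *
      exp (- (2 * \<alpha> / real DIM('a)) * (norm x)\<^sup>2 / r)) \<le> potential \<alpha> lam u x t"
proof -
  define n where "n = real DIM('a)"
  have n: "n > 0" by (simp add: n_def)
  \<comment> \<open>These times keep \<open>t - q\<close> between \<open>r / 4\<close> and
    \<open>r\<close>, and the age \<open>q - s + r\<close> of the kernel below \<open>u\<close>
    between \<open>r / 2\<close> and \<open>3 * r / 4\<close>.\<close>
  define B :: "('a \<times> real) set" where "B = cball 0 (sqrt r) \<times> {s - r/2 .. s - r/4}"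
  \<comment> \<open>The first factor uses \<open>|x - y|^2 \<le> 2 |x|^2 + 2 r\<close> and age at
    least \<open>r / 4\<close>; in the second, \<open>|y|^2 \<le> r\<close> and age at least
    \<open>r / 2\<close> give the factor \<open>exp (- 1 / 2)\<close>.\<close>
  define L where "L = ((4 * pi * r) powr (- n / 2) * exp (- (2 * (norm x)\<^sup>2 + 2 * r) / r)) powr (\<alpha> / n) *
     (r powr \<eta> * ((4 * pi * r) powr (- n / 2) * exp (- 1 / 2))) powr lam"
  have L: "L \<ge> 0" by (simp add: L_def)
  have ptw: "L \<le> heat_kernel (x - y) (t - q) powr (\<alpha> / n) * u (y, q) powr lam" if "(y, q) \<in> B" for y q
  proof -
    have y: "norm y \<le> sqrt r" and q: "s - r/2 \<le> q" "q \<le> s - r/4" using that by (auto simp: B_def)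
    have y2: "(norm y)\<^sup>2 \<le> r" using y r(1)
      by (metis norm_ge_zero power_mono real_sqrt_pow2 less_imp_le)
    have "(norm (x - y))\<^sup>2 \<le> (norm x + norm y)\<^sup>2"
      by (intro power_mono norm_triangle_ineq4) auto
    also have "\<dots> \<le> 2 * (norm x)\<^sup>2 + 2 * (norm y)\<^sup>2"
      using sum_squares_bound[of "norm x" "norm y"] by (simp add: power2_sum)
    finally have xy: "(norm (x - y))\<^sup>2 \<le> 2 * (norm x)\<^sup>2 + 2 * r" using y2 by simp
    have "(4 * pi * r) powr (- n / 2) * exp (- (2 * (norm x)\<^sup>2 + 2 * r) / r)
       \<le> (4 * pi * r) powr (- n / 2) * exp (- (norm (x - y))\<^sup>2 / (4 * (r / 4)))"
      using divide_right_mono[of "- (2 * (norm x)\<^sup>2 + 2 * r)" "- (norm (x - y))\<^sup>2" r] xy r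
      by (intro mult_left_mono) auto
    also have "\<dots> \<le> heat_kernel (x - y) (t - q)"
      unfolding n_def using r q t by (intro heat_kernel_lower) auto
    finally have 1: "((4 * pi * r) powr (- n / 2) * exp (- (2 * (norm x)\<^sup>2 + 2 * r) / r)) powr (\<alpha> / n)
       \<le> heat_kernel (x - y) (t - q) powr (\<alpha> / n)"
      using assms(1) n by (intro powr_mono2) auto
    have "(4 * pi * r) powr (- n / 2) * exp (- 1 / 2) \<le> (4 * pi * r) powr (- n / 2) * exp (- (norm y)\<^sup>2 / (4 * (r / 2)))"
      using y2 r by (auto intro!: mult_left_mono simp: field_simps)
    also have "\<dots> \<le> heat_kernel y (q - s + r)"
      unfolding n_def using r q by (intro heat_kernel_lower) auto
    finally have "r powr \<eta> * ((4 * pi * r) powr (- n / 2) * exp (- 1 / 2)) \<le> r powr \<eta> * heat_kernel y (q - s + r)"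
      by (intro mult_left_mono) auto
    also have "\<dots> \<le> u (y, q)" using q r by (intro u) auto
    finally have 2: "(r powr \<eta> * ((4 * pi * r) powr (- n / 2) * exp (- 1 / 2))) powr lam \<le> u (y, q) powr lam"
      using assms(2) by (intro powr_mono2) auto
    show ?thesis unfolding L_def using 1 2 by (intro mult_mono) auto
  qed
  have emB: "emeasure lborel B = ennreal (unit_ball_vol n * sqrt r ^ DIM('a) * (r / 4))"
  proof -
    have "emeasure lborel B = emeasure lborel (cball (0::'a) (sqrt r)) * emeasure lborel {s - r/2 .. s - r/4}"
      unfolding B_def lborel_prod[symmetric] by (rule lborel.emeasure_pair_measure_Times) auto
    also have "\<dots> = ennreal (unit_ball_vol n * sqrt r ^ DIM('a)) * ennreal (r / 4)"
      using r by (simp add: emeasure_cball n_def)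
    also have "\<dots> = ennreal (unit_ball_vol n * sqrt r ^ DIM('a) * (r / 4))"
      using r n by (intro ennreal_mult[symmetric]) auto
    finally show ?thesis .
  qed
  have "ennreal (L * (unit_ball_vol n * sqrt r ^ DIM('a) * (r / 4))) = ennreal L * emeasure lborel B"
    unfolding emB using L r n by (intro ennreal_mult) auto
  also have "\<dots> = (\<integral>\<^sup>+ w. ennreal L * indicator B w \<partial>lborel)"
    by (subst nn_integral_cmult_indicator)
       (auto simp: B_def borel_prod[symmetric] simp del: borel_prod)
  also have "\<dots> \<le> potential \<alpha> lam u x t"
    unfolding potential_def
  proof (rule nn_integral_mono)
    fix w :: "'a \<times> real"
    show "ennreal L * indicator B w \<le> ennreal (heat_kernel (x - fst w) (t - snd w) powr (\<alpha> / real DIM('a)) * u w powr lam) *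
        indicator (UNIV \<times> {0<..<1}) w"
    proof (cases "w \<in> B")
      case True
      then have "0 < snd w" "snd w < 1" using r t by (auto simp: B_def)
      then have "w \<in> UNIV \<times> {0<..<1}" by (auto simp: mem_Times_iff)
      then show ?thesis using ptw[of "fst w" "snd w"] True by (auto simp: n_def intro!: ennreal_leI)
    qed simp
  qed
  also have "L * (unit_ball_vol n * sqrt r ^ DIM('a) * (r / 4)) =
     K * r powr (1 + n / 2 - \<alpha> / 2 + (\<eta> - n / 2) * lam) * exp (- (2 * \<alpha> / n) * (norm x)\<^sup>2 / r)"
  proof -
    have a: "((4 * pi * r) powr (- n / 2) * exp (- (2 * (norm x)\<^sup>2 + 2 * r) / r)) powr (\<alpha> / n)
       = (4 * pi) powr (- \<alpha> / 2) * r powr (- \<alpha> / 2) * (exp (- (2 * \<alpha> / n) * (norm x)\<^sup>2 / r) * exp (- 2 * \<alpha> / n))"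
    proof -
      have "exp (- (2 * (norm x)\<^sup>2 + 2 * r) / r) powr (\<alpha> / n) = exp (- (2 * \<alpha> / n) * (norm x)\<^sup>2 / r) * exp (- 2 * \<alpha> / n)"
        using r n by (simp add: powr_def exp_add[symmetric] field_simps)
      then show ?thesis using r n by (simp add: powr_mult powr_powr)
    qed
    have b: "(r powr \<eta> * ((4 * pi * r) powr (- n / 2) * exp (- 1 / 2))) powr lam
       = r powr ((\<eta> - n / 2) * lam) * ((4 * pi) powr (- n / 2) * exp (- 1 / 2)) powr lam"
    proof -
      have eq: "r powr \<eta> * ((4 * pi * r) powr (- n / 2) * exp (- 1 / 2))
         = r powr (\<eta> - n / 2) * ((4 * pi) powr (- n / 2) * exp (- 1 / 2))"
        using r powr_add[of r \<eta> "- n / 2"] by (simp add: powr_mult)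
      show ?thesis unfolding eq using r by (simp add: powr_mult powr_powr)
    qed
    have c: "sqrt r ^ DIM('a) = r powr (n / 2)"
      using r by (simp add: powr_half_sqrt[symmetric] powr_realpow[symmetric] powr_powr n_def)
    have d: "r powr (1 + n / 2 - \<alpha> / 2 + (\<eta> - n / 2) * lam)
       = r * r powr (n / 2) * r powr (- \<alpha> / 2) * r powr ((\<eta> - n / 2) * lam)"
      using r powr_add[of r "1 + n / 2 - \<alpha> / 2" "(\<eta> - n / 2) * lam"] powr_add[of r "1 + n / 2" "- \<alpha> / 2"] powr_add[of r 1 "n / 2"]
      by simp
    show ?thesis unfolding L_def a b c d K_def n_def[symmetric] by (simp add: mult_ac)
  qed
  finally show ?thesis unfolding n_def .
qed

text \<open>The exponent \<open>\<delta>\<close> is that of the source,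
  \<open>\<eta> - 1 - n / 2\<close>, minus those of the lower bounds for the potential and for
  \<open>u powr \<sigma>\<close>. The condition relating \<open>c\<close> to \<open>\<alpha>\<close>
  and \<open>\<sigma>\<close> makes the pulse so narrow that its Gaussian is dominated by the
  product of the Gaussians of those lower bounds for every \<open>x\<close>, not only near the
  origin.\<close>

lemma source_estimate:
  fixes \<alpha> lam \<sigma> \<eta> c B :: real
  assumes pos: "\<alpha> > 0" "lam > 0" "\<sigma> > 0" "B > 0" and c: "0 < c" "c \<le> 1 / 2"
    and c': "2 * \<alpha> / real DIM('a) + \<sigma> / 4 \<le> 1 / (8 * c)"
  defines "\<delta> \<equiv> \<eta> - 1 - real DIM('a) / 2 - (1 + real DIM('a) / 2 - \<alpha> / 2 + (\<eta> - real DIM('a) / 2) * (lam + \<sigma>))"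
  obtains K where "K > 0"
    "\<And>u s r t (x::'a::euclidean_space). \<lbrakk>0 < r; r \<le> s; s \<le> t; t \<le> s + c * r; t < 1;
      \<And>y q. s - r / 2 \<le> q \<Longrightarrow> q \<le> t \<Longrightarrow> r powr \<eta> * heat_kernel y (q - s + r) \<le> u (y, q)\<rbrakk> \<Longrightarrow>
      ennreal (r powr \<eta> * (B / (c * r) * heat_kernel x (t - (s - c * r))))
        \<le> ennreal (K * r powr \<delta>) * (potential \<alpha> lam u x t * ennreal (u (x, t) powr \<sigma>))"
proof -
  define n where "n = real DIM('a)"
  have n: "n > 0" by (simp add: n_def)
  define K1 where "K1 = (4 * pi) powr (- \<alpha> / 2) * exp (- 2 * \<alpha> / n) *
     ((4 * pi) powr (- n / 2) * exp (- 1 / 2)) powr lam * unit_ball_vol n / 4"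
  define K2 where "K2 = (8 * pi) powr (- n * \<sigma> / 2)"
  define K3 where "K3 = B / c * (4 * pi * c) powr (- n / 2)"
  have K: "K1 > 0" "K2 > 0" "K3 > 0" using pos c n by (auto simp: K1_def K2_def K3_def)
  have "ennreal (r powr \<eta> * (B / (c * r) * heat_kernel x (t - (s - c * r))))
        \<le> ennreal (K3 / (K1 * K2) * r powr \<delta>) * (potential \<alpha> lam u x t * ennreal (u (x, t) powr \<sigma>))"
    if r: "0 < r" "r \<le> s" and t: "s \<le> t" "t \<le> s + c * r" "t < 1"
      and u: "\<And>y q. s - r / 2 \<le> q \<Longrightarrow> q \<le> t \<Longrightarrow> r powr \<eta> * heat_kernel y (q - s + r) \<le> u (y, q)"
    for u s r t and x :: 'a
  proof -
    \<comment> \<open>The parabolic variable, in which all Gaussians involved become exponentials of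
      multiples of \<open>X\<close>.\<close>
    define X where "X = (norm x)\<^sup>2 / r"
    have X: "X \<ge> 0" using r by (simp add: X_def)
    have cr: "c * r \<le> r / 2" using c r by simp
    then have tr: "t - s + r \<le> 2 * r" using t r by linarith
    define L1 where "L1 = K1 * r powr (1 + n / 2 - \<alpha> / 2 + (\<eta> - n / 2) * lam) * exp (- (2 * \<alpha> / n) * X)"
    define L2 where "L2 = K2 * r powr ((\<eta> - n / 2) * \<sigma>) * exp (- (\<sigma> / 4) * X)"
    have I: "ennreal L1 \<le> potential \<alpha> lam u x t"
    proof -
      have t2: "t \<le> s + r / 2" using t cr by simp
      have "r powr \<eta> * heat_kernel y (q - s + r) \<le> u (y, q)" if "s - r / 2 \<le> q" "q \<le> s" for y q
        using that t by (intro u) auto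
      from potential_lower[OF pos(1,2) r t(1) t2 t(3) this, of x] show ?thesis
        by (simp add: L1_def K1_def n_def X_def)
    qed
    have U: "L2 \<le> u (x, t) powr \<sigma>"
    proof -
      \<comment> \<open>At time \<open>t\<close> the kernel below \<open>u\<close> has age between
        \<open>r\<close> and \<open>2 * r\<close>.\<close>
      have "r powr \<eta> * ((4 * pi * (2 * r)) powr (- n / 2) * exp (- (norm x)\<^sup>2 / (4 * r))) \<le> r powr \<eta> * heat_kernel x (t - s + r)"
        unfolding n_def using r t tr by (intro mult_left_mono heat_kernel_lower) auto
      also have "\<dots> \<le> u (x, t)" using r t by (intro u) auto
      finally have "(r powr \<eta> * ((4 * pi * (2 * r)) powr (- n / 2) * exp (- (norm x)\<^sup>2 / (4 * r)))) powr \<sigma> \<le> u (x, t) powr \<sigma>"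
        using pos by (intro powr_mono2) auto
      also have "(r powr \<eta> * ((4 * pi * (2 * r)) powr (- n / 2) * exp (- (norm x)\<^sup>2 / (4 * r)))) powr \<sigma> = L2"
      proof -
        have eq: "r powr \<eta> * ((4 * pi * (2 * r)) powr (- n / 2) * exp (- (norm x)\<^sup>2 / (4 * r)))
          = (8 * pi) powr (- n / 2) * r powr (\<eta> - n / 2) * exp (- X / 4)"
          using r powr_add[of r \<eta> "- n / 2"] powr_mult[of "8 * pi" r "- n / 2"] by (simp add: X_def mult_ac)
        have "exp (- X / 4) powr \<sigma> = exp (- (\<sigma> / 4) * X)"
          by (simp add: powr_def)
        then show ?thesis unfolding eq using r by (simp add: L2_def K2_def powr_mult powr_powr)
      qed
      finally show ?thesis .
    qed
    \<comment> \<open>While it is being switched on, the new kernel has age between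
      \<open>c * r\<close> and \<open>2 * c * r\<close>; the upper end yields the rate
      \<open>1 / (8 * c)\<close>.\<close>
    have "r powr \<eta> * (B / (c * r) * heat_kernel x (t - (s - c * r)))
       \<le> r powr \<eta> * (B / (c * r) * ((4 * pi * (c * r)) powr (- n / 2) * exp (- (norm x)\<^sup>2 / (4 * (2 * c * r)))))"
      unfolding n_def using r t c pos by (intro mult_left_mono heat_kernel_upper) auto
    also have "\<dots> = K3 * r powr (\<eta> - 1 - n / 2) * exp (- (1 / (8 * c)) * X)"
    proof -
      have "(4 * pi * (c * r)) powr (- n / 2) = (4 * pi * c) powr (- n / 2) * r powr (- n / 2)"
        using r c by (simp add: powr_mult)
      moreover have "r powr (\<eta> - 1 - n / 2) = r powr \<eta> * r powr (- n / 2) / r"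
        using r powr_diff[of r "\<eta> - n / 2" 1] powr_add[of r \<eta> "- n / 2"] by (simp add: algebra_simps)
      moreover have "- (norm x)\<^sup>2 / (4 * (2 * c * r)) = - (1 / (8 * c)) * X"
        by (simp add: X_def)
      ultimately show ?thesis by (simp add: K3_def)
    qed
    also have "\<dots> \<le> K3 * r powr (\<eta> - 1 - n / 2) * exp (- (2 * \<alpha> / n + \<sigma> / 4) * X)"
      using K mult_right_mono[OF c' X] by (intro mult_left_mono) (auto simp: n_def algebra_simps)
    also have "\<dots> = K3 / (K1 * K2) * r powr \<delta> * (L1 * L2)"
    proof -
      have "r powr (\<eta> - 1 - n / 2) = r powr \<delta> * (r powr (1 + n / 2 - \<alpha> / 2 + (\<eta> - n / 2) * lam) * r powr ((\<eta> - n / 2) * \<sigma>))"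
        unfolding powr_add[symmetric] \<delta>_def n_def[symmetric] by (simp add: algebra_simps add_divide_distrib)
      moreover have "exp (- (2 * \<alpha> / n + \<sigma> / 4) * X) = exp (- (2 * \<alpha> / n) * X) * exp (- (\<sigma> / 4) * X)"
        unfolding exp_add[symmetric] by (simp add: algebra_simps)
      ultimately show ?thesis using K by (simp add: L1_def L2_def)
    qed
    finally have "ennreal (r powr \<eta> * (B / (c * r) * heat_kernel x (t - (s - c * r)))) \<le> ennreal (K3 / (K1 * K2) * r powr \<delta> * (L1 * L2))"
      by (rule ennreal_leI)
    also have "\<dots> = ennreal (K3 / (K1 * K2) * r powr \<delta>) * (ennreal L1 * ennreal L2)"
    proof -
      have k: "0 \<le> K3 / (K1 * K2) * r powr \<delta>" and L: "0 \<le> L1" "0 \<le> L2"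
        using K by (auto simp: L1_def L2_def)
      show ?thesis unfolding ennreal_mult[OF k mult_nonneg_nonneg[OF L]] ennreal_mult[OF L] ..
    qed
    also have "\<dots> \<le> ennreal (K3 / (K1 * K2) * r powr \<delta>) * (potential \<alpha> lam u x t * ennreal (u (x, t) powr \<sigma>))"
      by (intro mult_left_mono mult_mono I ennreal_leI U) auto
    finally show ?thesis .
  qed
  note main = this
  show ?thesis
  proof (rule that)
    show "K3 / (K1 * K2) > 0" using K by simp
  qed (fact main)
qed

text \<open>A code dominates both components of its pair, so the first \<open>M\<close> codes lie in
  a square. Partial sums are therefore bounded by a product of two geometric series.\<close>

lemma summable_power_prod_decode:
  assumes "0 \<le> q" "q < (1::real)"
  shows "summable (\<lambda>i. q ^ (fst (prod_decode i) + snd (prod_decode i)))"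
proof (rule summableI_nonneg_bounded)
  fix M
  have fin: "prod_decode ` {..<M} \<subseteq> {..<Suc M} \<times> {..<Suc M}"
  proof
    fix p assume "p \<in> prod_decode ` {..<M}"
    then obtain i where i: "i < M" "prod_encode p = i" by auto
    then have "fst p \<le> i" "snd p \<le> i"
      using le_prod_encode_1[of "fst p" "snd p"] le_prod_encode_2[of "snd p" "fst p"] by auto
    then show "p \<in> {..<Suc M} \<times> {..<Suc M}" using i by (auto simp: mem_Times_iff)
  qed
  have "(\<Sum>i<M. q ^ (fst (prod_decode i) + snd (prod_decode i))) = (\<Sum>p\<in>prod_decode ` {..<M}. q ^ (fst p + snd p))"
    by (subst sum.reindex) (auto simp: inj_prod_decode)
  also have "\<dots> \<le> (\<Sum>p\<in>{..<Suc M} \<times> {..<Suc M}. q ^ (fst p + snd p))"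
    using assms by (intro sum_mono2 fin) auto
  also have "\<dots> = (\<Sum>j<Suc M. q ^ j) * (\<Sum>k<Suc M. q ^ k)"
    unfolding sum_product sum.cartesian_product by (simp add: power_add case_prod_beta del: lessThan_Suc sum.lessThan_Suc)
  also have "\<dots> \<le> 1 / (1 - q) * (1 / (1 - q))"
  proof -
    have "(\<Sum>j<Suc M. q ^ j) \<le> 1 / (1 - q)"
      using sum_le_suminf[OF summable_geometric[of q], of "{..<Suc M}"] assms by (simp add: suminf_geometric)
    moreover have "0 \<le> (\<Sum>j<Suc M. q ^ j)" using assms by (intro sum_nonneg) auto
    ultimately show ?thesis using assms by (intro mult_mono) (auto simp del: sum.lessThan_Suc)
  qed
  finally show "(\<Sum>i<M. q ^ (fst (prod_decode i) + snd (prod_decode i))) \<le> 1 / (1 - q) * (1 / (1 - q))" .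
qed (use assms in auto)

section \<open>Bursts\<close>

text \<open>Burst \<open>j\<close> runs through the stages up to \<open>N j\<close>. The function
  \<open>N\<close> stays arbitrary here and is later chosen to beat \<open>\<phi>\<close>; the
  overall size \<open>T0\<close> is later taken small to make the sum of all ratios small.\<close>

locale burst_schedule =
  fixes T0 c \<eta> :: real and N :: "nat \<Rightarrow> nat"
  assumes c: "0 < c" "c \<le> 1 / 16" and T0: "0 < T0" "T0 \<le> 1 / 4" and \<eta>: "0 < \<eta>"
begin

definition \<kappa> :: real where "\<kappa> = 3 * c / (1 - 4 * c)"
text \<open>The ratio \<open>4 * c\<close> makes the scale of a stage equal to the age of its
  predecessor's kernel at the start of the stage: the kernel is centred \<open>c * scale j k\<close>
  before \<open>start j k\<close>, and the next stage starts \<open>3 * c * scale j k\<close> after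
  it.\<close>

definition scale :: "nat \<Rightarrow> nat \<Rightarrow> real" where "scale j k = T0 * (4 * c) ^ (j + k)"
text \<open>The value of \<open>\<kappa>\<close> makes \<open>start j (k + 1) = start j k + 3 * c * scale j k\<close>.\<close>

definition start :: "nat \<Rightarrow> nat \<Rightarrow> real" where "start j k = scale j 0 + \<kappa> * (scale j 0 - scale j k)"

text \<open>Stages beyond \<open>N j\<close> keep their index and receive mass 0, so a single
  enumeration of all pairs serves every choice of \<open>N\<close>.\<close>

definition mass :: "nat \<Rightarrow> real" where
  "mass i = (case prod_decode i of (j, k) \<Rightarrow> if k \<le> N j then scale j k powr \<eta> else 0)"
definition onset :: "nat \<Rightarrow> real" where
  "onset i = (case prod_decode i of (j, k) \<Rightarrow> start j k)"
definition width :: "nat \<Rightarrow> real" where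
  "width i = (case prod_decode i of (j, k) \<Rightarrow> c * scale j k)"

lemma scale_pos: "0 < scale j k"
  using c T0 by (simp add: scale_def)

lemma scale_Suc: "scale j (Suc k) = 4 * c * scale j k"
  by (simp add: scale_def)

lemma scale_le_first: "scale j k \<le> scale j 0"
proof -
  have "(4 * c) ^ (j + k) \<le> (4 * c) ^ j" using c by (intro power_decreasing) auto
  then show ?thesis using T0 by (simp add: scale_def)
qed

lemma scale_le: "scale j k \<le> 1 / 4"
proof -
  have "T0 * (4 * c) ^ (j + k) \<le> 1 / 4 * 1" using c T0 by (intro mult_mono power_le_one) auto
  then show ?thesis by (simp add: scale_def)
qed

lemma \<kappa>: "0 \<le> \<kappa>" "\<kappa> \<le> 1 / 4"
  using c by (auto simp: \<kappa>_def field_simps)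

lemma start_0: "start j 0 = scale j 0"
  by (simp add: start_def)

lemma start_Suc: "start j (Suc k) = start j k + 3 * c * scale j k"
proof -
  have "\<kappa> * (1 - 4 * c) = 3 * c" using c by (simp add: \<kappa>_def)
  then have "3 * c * scale j k = \<kappa> * (1 - 4 * c) * scale j k" by simp
  then show ?thesis by (simp add: start_def scale_Suc algebra_simps)
qed

lemma start_ge: "scale j 0 \<le> start j k"
  using \<kappa> scale_le_first[of j k] by (simp add: start_def)

text \<open>Together with \<open>start_ge\<close> this confines burst \<open>j\<close> to times
  between \<open>scale j 0\<close> and \<open>2 * scale j 0\<close>, however long its ladder
  is.\<close>

lemma end_le: "start j k + c * scale j k \<le> 2 * scale j 0"
proof -
  define A where "A = \<kappa> * (scale j 0 - scale j k)"
  define C where "C = c * scale j k"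
  have "A \<le> 1 / 4 * (scale j 0 - scale j k)"
    unfolding A_def using \<kappa> scale_le_first[of j k] by (intro mult_right_mono) auto
  moreover have "C \<le> 1 / 16 * scale j k"
    unfolding C_def using c scale_pos[of j k] by (intro mult_right_mono) auto
  ultimately show ?thesis using scale_pos[of j k] scale_le_first[of j k] scale_pos[of j 0]
    unfolding start_def A_def[symmetric] C_def[symmetric] by argo
qed

lemma scale_tendsto_0: "(\<lambda>j. scale j 0) \<longlonglongrightarrow> 0"
proof -
  have "(\<lambda>j. T0 * (4 * c) ^ j) \<longlonglongrightarrow> T0 * 0"
    using c by (intro tendsto_mult tendsto_const LIMSEQ_power_zero) auto
  then show ?thesis by (simp add: scale_def)
qed

lemma scale_powr: "scale j k powr p = T0 powr p * ((4 * c) powr p) ^ (j + k)"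
proof -
  have "(x ^ m) powr p = (x powr p) ^ m" if "x > 0" for x :: real and m
    using that by (simp add: powr_realpow[symmetric] powr_powr mult.commute)
  from this[of "4 * c" "j + k"] have eq: "((4 * c) ^ (j + k)) powr p = ((4 * c) powr p) ^ (j + k)"
    using c by linarith
  show ?thesis unfolding scale_def eq[symmetric] by (rule powr_mult)
qed

lemma ratio_powr: "p > 0 \<Longrightarrow> 0 \<le> (4 * c) powr p" "p > 0 \<Longrightarrow> (4 * c) powr p < 1"
  using c powr_less_mono2[of p "4 * c" 1] by auto

lemma summable_scale_powr:
  assumes "p > 0"
  shows "summable (\<lambda>i. case prod_decode i of (j, k) \<Rightarrow> scale j k powr p)"
  using summable_mult[OF summable_power_prod_decode[OF ratio_powr[OF assms]], of "T0 powr p"]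
  by (simp add: scale_powr case_prod_beta)

lemma suminf_scale_powr:
  assumes "p > 0"
  shows "(\<Sum>i. case prod_decode i of (j, k) \<Rightarrow> scale j k powr p)
    = T0 powr p * (\<Sum>i. ((4 * c) powr p) ^ (fst (prod_decode i) + snd (prod_decode i)))"
  using suminf_mult[OF summable_power_prod_decode[OF ratio_powr[OF assms]], of "T0 powr p"]
  by (simp add: scale_powr case_prod_beta)

text \<open>Masses are powers of geometrically decreasing scales, so every positive power of them is
  summable; the powers 1, \<open>1 / 2\<close> and \<open>lam / 2\<close> occur later.\<close>

lemma summable_mass_powr:
  assumes "p > 0"
  shows "summable (\<lambda>i. mass i powr p)"
proof (rule summable_comparison_test'[OF summable_scale_powr[of "\<eta> * p"]])
  show "norm (mass i powr p) \<le> (case prod_decode i of (j, k) \<Rightarrow> scale j k powr (\<eta> * p))" for i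
    using assms by (auto simp: mass_def powr_powr split: prod.split)
qed (use assms \<eta> in auto)

lemma mass_nonneg: "0 \<le> mass i"
  by (simp add: mass_def split: prod.split)

text \<open>Only finitely many bursts reach beyond time \<open>\<delta>\<close>, and each has
  finitely many stages of nonzero mass because its ladder stops at \<open>N j\<close>.\<close>

lemma eventually_mass_past:
  assumes "0 < \<delta>"
  shows "\<forall>\<^sub>F i in sequentially. mass i = 0 \<or> onset i + width i \<le> \<delta>"
proof -
  obtain J where J: "\<And>j. j \<ge> J \<Longrightarrow> scale j 0 < \<delta> / 2"
    using order_tendstoD(2)[OF scale_tendsto_0, of "\<delta> / 2"] assms by (auto simp: eventually_sequentially)
  have "{i. \<not> (mass i = 0 \<or> onset i + width i \<le> \<delta>)} \<subseteq> prod_encode ` (SIGMA j:{..<J}. {..N j})"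
  proof
    fix i assume i: "i \<in> {i. \<not> (mass i = 0 \<or> onset i + width i \<le> \<delta>)}"
    obtain j k where jk: "prod_decode i = (j, k)" by fastforce
    have "k \<le> N j" using i jk by (auto simp: mass_def split: if_splits)
    moreover have "j < J"
    proof (rule ccontr)
      assume "\<not> j < J"
      then have "start j k + c * scale j k \<le> \<delta>" using J[of j] end_le[of j k] by simp
      then show False using i jk by (simp add: onset_def width_def)
    qed
    ultimately have "(j, k) \<in> (SIGMA j:{..<J}. {..N j})" by auto
    moreover have "i = prod_encode (j, k)" using jk by (metis prod_decode_inverse)
    ultimately show "i \<in> prod_encode ` (SIGMA j:{..<J}. {..N j})" by blast
  qed
  then have "finite {i. \<not> (mass i = 0 \<or> onset i + width i \<le> \<delta>)}"
    by (rule finite_subset) (intro finite_imageI finite_SigmaI; simp)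
  then show ?thesis unfolding cofinite_eq_sequentially[symmetric] eventually_cofinite .
qed

sublocale pulse_train mass onset width
proof
  show "summable mass"
    using summable_mass_powr[of 1] mass_nonneg by simp
  show "0 < width i" for i using c scale_pos by (simp add: width_def split: prod.split)
  show "0 \<le> onset i - width i" for i
  proof -
    have "c * scale j k \<le> start j k" for j k
    proof -
      have "c * scale j k \<le> 1 * scale j k" using c scale_pos[of j k] by (intro mult_right_mono) auto
      then show ?thesis using scale_le_first[of j k] start_ge[of j k] by linarith
    qed
    then show ?thesis by (simp add: onset_def width_def split: prod.split)
  qed
qed (use mass_nonneg eventually_mass_past in auto)

section \<open>Lower bounds along a ladder and the differential inequality for the full
  series\<close>

lemma train_ge_stage:
  fixes x :: "'a::euclidean_space"
  assumes "k \<le> N j" "start j k + c * scale j k \<le> t"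
  shows "scale j k powr \<eta> * heat_kernel x (t - (start j k - c * scale j k)) \<le> train (x, t)"
proof -
  define i where "i = prod_encode (j, k)"
  have w: "0 < c * scale j k" using c scale_pos by simp
  have "snd (x, t) > 0" using assms w start_ge[of j k] scale_pos[of j 0] by simp
  from train_ge_term[OF this, of i] show ?thesis
    using assms w by (simp add: term_fun_def i_def mass_def onset_def width_def pulse_after)
qed

text \<open>The predecessor of stage 0 is the initial heat kernel, whose age at
  \<open>start j 0\<close> is \<open>scale j 0\<close>; that of stage \<open>k' + 1\<close> is stage
  \<open>k'\<close>. In both cases the predecessor's mass is at least
  \<open>scale j k powr \<eta>\<close>.\<close>

lemma train_ge_previous_stage:
  fixes y :: "'a::euclidean_space"
  assumes k: "k \<le> N j" and q: "start j k - scale j k / 2 \<le> q"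
  shows "scale j k powr \<eta> * heat_kernel y (q - start j k + scale j k) \<le> train (y, q)"
proof (cases k)
  case 0
  have "q > 0" using q scale_pos[of j 0] 0 start_0[of j] by simp
  have "scale j k powr \<eta> \<le> 1"
    using scale_pos[of j k] scale_le[of j k] \<eta> by (intro powr_le1) auto
  then have "scale j k powr \<eta> * heat_kernel y q \<le> heat_kernel y q"
    using mult_right_mono[OF _ heat_kernel_nonneg[of y q]] by force
  also have "\<dots> \<le> train (y, q)" using train_ge_heat[of "(y, q)"] \<open>q > 0\<close> by simp
  finally show ?thesis using 0 start_0[of j] by simp
next
  case (Suc k')
  \<comment> \<open>Both sides are the age of the predecessor's kernel, by the choice of the ratio
    \<open>4 * c\<close>.\<close>
  have eq: "q - start j k + scale j k = q - (start j k' - c * scale j k')"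
    by (simp add: Suc start_Suc scale_Suc)
  have "scale j k \<le> scale j k'"
    using c scale_pos[of j k'] mult_right_mono[of "4 * c" 1 "scale j k'"] by (simp add: Suc scale_Suc)
  then have "scale j k powr \<eta> \<le> scale j k' powr \<eta>"
    using scale_pos[of j k] \<eta> by (intro powr_mono2) auto
  then have "scale j k powr \<eta> * heat_kernel y (q - start j k + scale j k)
     \<le> scale j k' powr \<eta> * heat_kernel y (q - start j k + scale j k)"
    by (intro mult_right_mono heat_kernel_nonneg)
  \<comment> \<open>The window reaches back exactly to the moment when the predecessor is fully on:
    \<open>scale j k / 2\<close> equals \<open>2 * c * scale j k'\<close>, which leaves
    \<open>c * scale j k'\<close> of the gap between the two starts.\<close>
  also have "\<dots> \<le> train (y, q)"
    unfolding eq using k q by (intro train_ge_stage) (auto simp: Suc start_Suc scale_Suc)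
  finally show ?thesis .
qed

text \<open>The assumption \<open>estimate\<close> is the conclusion of
  \<open>source_estimate\<close> with its constants fixed.\<close>

context
  fixes \<alpha> lam \<sigma> \<delta> K B :: real
  assumes B: "\<And>t. step' t \<le> B" and K: "K \<ge> 0"
    and estimate: "\<And>u s r t (x::'a::euclidean_space). \<lbrakk>0 < r; r \<le> s; s \<le> t; t \<le> s + c * r; t < 1;
      \<And>y q. s - r / 2 \<le> q \<Longrightarrow> q \<le> t \<Longrightarrow> r powr \<eta> * heat_kernel y (q - s + r) \<le> u (y, q)\<rbrakk> \<Longrightarrow>
      ennreal (r powr \<eta> * (B / (c * r) * heat_kernel x (t - (s - c * r))))
        \<le> ennreal (K * r powr \<delta>) * (potential \<alpha> lam u x t * ennreal (u (x, t) powr \<sigma>))"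
begin

text \<open>A source is nonzero only during the switching interval of a stage on the ladder, and
  there the predecessor supplies the lower bound on \<open>train\<close> that
  \<open>estimate\<close> asks for.\<close>

lemma source_le:
  fixes x :: 'a
  assumes t: "t < 1"
  shows "ennreal (source i (x, t)) \<le> ennreal (K * (case prod_decode i of (j, k) \<Rightarrow> scale j k powr \<delta>)) *
    (potential \<alpha> lam train x t * ennreal (train (x, t) powr \<sigma>))"
proof -
  obtain j k where jk: "prod_decode i = (j, k)" by fastforce
  define r where "r = scale j k"
  define s where "s = start j k"
  have r: "0 < r" "r \<le> s"
    using scale_pos[of j k] scale_le_first[of j k] start_ge[of j k] by (auto simp: r_def s_def)
  have cr: "0 < c * r" using c r by simp
  have src: "source i (x, t) = (if k \<le> N j then r powr \<eta> else 0) *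
      (step' ((t - s) / (c * r)) / (c * r) * heat_kernel x (t - (s - c * r)))"
    by (simp add: source_def mass_def onset_def width_def jk r_def s_def)
  show ?thesis
  proof (cases "k \<le> N j \<and> s \<le> t \<and> t \<le> s + c * r")
    case True
    have "source i (x, t) \<le> r powr \<eta> * (B / (c * r) * heat_kernel x (t - (s - c * r)))"
      unfolding src using True cr B
      by (auto intro!: mult_left_mono mult_right_mono divide_right_mono heat_kernel_nonneg)
    then have "ennreal (source i (x, t)) \<le> ennreal (r powr \<eta> * (B / (c * r) * heat_kernel x (t - (s - c * r))))"
      by (rule ennreal_leI)
    also have "\<dots> \<le> ennreal (K * r powr \<delta>) * (potential \<alpha> lam train x t * ennreal (train (x, t) powr \<sigma>))"
    proof (rule estimate[OF r _ _ t])
      show "s \<le> t" "t \<le> s + c * r" using True by auto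
      show "r powr \<eta> * heat_kernel y (q - s + r) \<le> train (y, q)" if "s - r / 2 \<le> q" for q and y :: 'a
        unfolding r_def s_def using True that by (intro train_ge_previous_stage) (auto simp: r_def s_def)
    qed
    finally show ?thesis by (simp add: jk r_def)
  next
    case False
    have "source i (x, t) = 0"
    proof (cases "k \<le> N j")
      case True
      then have "t \<le> s \<or> s + c * r \<le> t" using False by auto
      then have "step' ((t - s) / (c * r)) = 0"
        using cr by (intro step'_eq_0) (auto simp: divide_le_0_iff le_divide_eq_1)
      then show ?thesis by (simp add: src)
    qed (simp add: src)
    then show ?thesis by simp
  qed
qed

text \<open>Each source uses at most the fraction \<open>K * scale j k powr \<delta>\<close> of the
  right-hand side, and these fractions add up to at most 1; overlaps in time between pulses
  therefore do no harm.\<close>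

lemma heat_op_train_le:
  fixes x :: 'a
  assumes t: "0 < t" "t < 1" and \<delta>: "\<delta> > 0"
    and small: "K * (\<Sum>i. case prod_decode i of (j, k) \<Rightarrow> scale j k powr \<delta>) \<le> 1"
  shows "ennreal (heat_op train (x, t)) \<le> potential \<alpha> lam train x t * ennreal (train (x, t) powr \<sigma>)"
proof (cases "potential \<alpha> lam train x t * ennreal (train (x, t) powr \<sigma>)")
  case top
  then show ?thesis by simp
next
  case (real g)
  let ?w = "\<lambda>i. case prod_decode i of (j, k) \<Rightarrow> scale j k powr \<delta>"
  have "source i (x, t) \<le> K * ?w i * g" for i
  proof -
    have nn: "0 \<le> K * ?w i" using K by (auto split: prod.split)
    have "ennreal (source i (x, t)) \<le> ennreal (K * ?w i * g)"
      using source_le[OF t(2), of i x] real nn by (simp add: ennreal_mult)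
    then show ?thesis using nn real(1) by (subst (asm) ennreal_le_iff) auto
  qed
  moreover have sums: "summable (\<lambda>i. source i (x, t))" "heat_op train (x, t) = (\<Sum>i. source i (x, t))"
    using heat_op_train_sums[of "(x, t)"] t by (auto simp: sums_iff)
  ultimately have "heat_op train (x, t) \<le> (\<Sum>i. K * ?w i * g)"
    unfolding sums(2)
    by (intro suminf_le sums(1) summable_mult summable_mult2 summable_scale_powr[OF \<delta>])
  also have "\<dots> = K * suminf ?w * g"
    using summable_scale_powr[OF \<delta>] by (simp add: suminf_mult suminf_mult2[symmetric] summable_mult)
  also have "\<dots> \<le> 1 * g" using small real(1) by (intro mult_right_mono) auto
  finally show ?thesis unfolding real(2) by (simp add: ennreal_leI)
qed

end

end

section \<open>Growth at the spatial origin\<close>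

lemma exists_tall_stage:
  fixes \<phi> :: "real \<Rightarrow> real"
  assumes "0 < a" "a \<le> b" "b < 1" "continuous_on {0<..<1} \<phi>"
    and h: "filterlim h at_top sequentially"
  shows "\<exists>N. \<forall>q\<in>{a..b}. M * \<phi> q \<le> h N"
proof -
  have "continuous_on {a..b} \<phi>"
    by (rule continuous_on_subset[OF assms(4)]) (use assms in auto)
  then have "bounded (\<phi> ` {a..b})"
    by (intro compact_imp_bounded compact_continuous_image) auto
  then obtain P where P: "\<And>q. q \<in> {a..b} \<Longrightarrow> \<bar>\<phi> q\<bar> \<le> P"
    by (force simp: bounded_iff)
  \<comment> \<open>\<open>\<phi>\<close> is bounded on the compact window while \<open>h\<close>
    passes every bound, so one index serves all times of the window.\<close>
  obtain N where N: "\<bar>M\<bar> * P \<le> h N"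
    using h by (auto simp: filterlim_at_top eventually_sequentially)
  have "M * \<phi> q \<le> h N" if "q \<in> {a..b}" for q
  proof -
    have "M * \<phi> q \<le> \<bar>M\<bar> * \<bar>\<phi> q\<bar>" by (metis abs_ge_self abs_mult)
    also have "\<dots> \<le> \<bar>M\<bar> * P" using P[OF that] by (intro mult_left_mono) auto
    finally show ?thesis using N by simp
  qed
  then show ?thesis by blast
qed

context burst_schedule
begin

text \<open>When the last stage is fully on, its kernel has age twice
  \<open>c * scale j (N j)\<close>, which turns \<open>4 * pi\<close> into
  \<open>8 * pi\<close>.\<close>

lemma train_at_peak:
  "scale j (N j) powr \<eta> * (8 * pi * c * scale j (N j)) powr (- real DIM('a) / 2)
     \<le> train (0::'a::euclidean_space, start j (N j) + c * scale j (N j))"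
  using train_ge_stage[of "N j" j "start j (N j) + c * scale j (N j)" "0::'a"] c scale_pos[of j "N j"]
  by (simp add: heat_kernel_def mult_ac)

text \<open>The ends of the bursts tend to 0, and at the end of burst \<open>j\<close> the value at
  the origin is at least \<open>j\<close> times \<open>\<phi>\<close>, which defeats every
  constant.\<close>

lemma train_not_bigo:
  fixes \<phi> :: "real \<Rightarrow> real"
  assumes pos: "\<forall>t\<in>{0<..<1}. \<phi> t > 0"
    and tall: "\<And>j q. q \<in> {scale j 0..2 * scale j 0} \<Longrightarrow>
      real j * \<phi> q \<le> scale j (N j) powr \<eta> * (8 * pi * c * scale j (N j)) powr (- real DIM('a) / 2)"
  shows "(\<lambda>t. train (0::'a::euclidean_space, t)) \<notin> O[at_right 0](\<phi>)"
proof
  assume "(\<lambda>t. train (0::'a, t)) \<in> O[at_right 0](\<phi>)"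
  then obtain C where C: "C > 0" "\<forall>\<^sub>F t in at_right 0. norm (train (0::'a, t)) \<le> C * norm (\<phi> t)"
    by (rule landau_o.bigE)
  then obtain b where b: "b > 0" "\<And>t. 0 < t \<Longrightarrow> t < b \<Longrightarrow> \<bar>train (0::'a, t)\<bar> \<le> C * \<bar>\<phi> t\<bar>"
    by (auto simp: eventually_at_right[OF zero_less_one])
  have s: "\<forall>\<^sub>F j in sequentially. scale j 0 < b / 2"
    using order_tendstoD(2)[OF scale_tendsto_0, of "b / 2"] b by simp
  have r: "\<forall>\<^sub>F j in sequentially. C < real j"
    using filterlim_real_sequentially by (simp add: filterlim_at_top_dense)
  obtain j where j: "scale j 0 < b / 2" "C < real j"
    using eventually_happens'[OF sequentially_bot eventually_conj[OF s r]] by blast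
  define t where "t = start j (N j) + c * scale j (N j)"
  have t: "scale j 0 \<le> t" "t \<le> 2 * scale j 0"
    using start_ge[of j "N j"] end_le[of j "N j"] c scale_pos[of j "N j"] by (auto simp: t_def add_increasing2)
  have t0: "0 < t" "t < 1" "t < b" using t scale_pos[of j 0] scale_le[of j 0] j by auto
  have "real j * \<phi> t \<le> train (0::'a, t)"
    using tall[of t j] train_at_peak[of j, where ?'a = 'a] t by (simp add: t_def)
  also have "\<dots> \<le> C * \<phi> t"
    using b(2)[of t] t0 pos[rule_format, of t] by simp
  finally show False using j(2) pos t0 by (auto simp: mult_le_cancel_right)
qed

end

text \<open>Up to a constant factor the product is the scale to the negative power \<open>p\<close>,
  and the scales tend to 0. The split into exponents \<open>q\<close> and \<open>p - q\<close>
  reproduces mass times kernel height, with \<open>q = \<eta>\<close> and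
  \<open>p = \<eta> - n / 2\<close>.\<close>

lemma filterlim_peak:
  fixes c T p q :: real
  assumes "0 < c" "4 * c < 1" "0 < T" "p < 0" "0 < a"
  shows "filterlim (\<lambda>k. (T * (4 * c) ^ (j + k)) powr q * (a * (T * (4 * c) ^ (j + k))) powr (p - q)) at_top sequentially"
proof -
  have lim: "filterlim (\<lambda>k. T * (4 * c) ^ (j + k)) (at_right 0) sequentially"
  proof (rule tendsto_imp_filterlim_at_right)
    have "(\<lambda>k. T * (4 * c) ^ j * (4 * c) ^ k) \<longlonglongrightarrow> T * (4 * c) ^ j * 0"
      using assms by (intro tendsto_mult tendsto_const LIMSEQ_power_zero) auto
    then show "(\<lambda>k. T * (4 * c) ^ (j + k)) \<longlonglongrightarrow> 0" by (simp add: power_add mult.assoc)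
  qed (use assms in auto)
  have "filterlim (\<lambda>r. a powr (p - q) * r powr p) at_top (at_right (0::real))"
    using assms by real_asymp
  from filterlim_compose[OF this lim]
  show ?thesis
  proof (rule filterlim_cong[THEN iffD1, rotated 3])
    show "\<forall>\<^sub>F k in sequentially. a powr (p - q) * (T * (4 * c) ^ (j + k)) powr p
       = (T * (4 * c) ^ (j + k)) powr q * (a * (T * (4 * c) ^ (j + k))) powr (p - q)"
    proof (rule always_eventually, rule allI)
      fix k
      define r where "r = T * (4 * c) ^ (j + k)"
      have "r > 0" using assms by (simp add: r_def)
      then have "r powr p = r powr q * r powr (p - q)" by (simp add: powr_add[symmetric])
      then show "a powr (p - q) * (T * (4 * c) ^ (j + k)) powr p
       = (T * (4 * c) ^ (j + k)) powr q * (a * (T * (4 * c) ^ (j + k))) powr (p - q)"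
        unfolding r_def[symmetric] using \<open>r > 0\<close> assms by (simp add: powr_mult)
    qed
  qed auto
qed

section \<open>Choice of the exponents, the scales and the ladder lengths\<close>

theorem theorem3p2:
  fixes \<alpha> lam \<sigma> :: real and \<phi> :: "real \<Rightarrow> real"
  assumes "0 < \<alpha>" "\<alpha> < real DIM('a::euclidean_space) + 2"
    and "0 < lam" "lam < (real DIM('a) + 2) / real DIM('a)"
    and "\<sigma> > (2 * (real DIM('a) + 2) - \<alpha>) / real DIM('a) - lam"
    and "continuous_on {0<..<1} \<phi>" "\<forall>t\<in>{0<..<1}. \<phi> t > 0"
    and "filterlim \<phi> at_top (at_right 0)"
  shows "\<exists>u :: 'a \<times> real \<Rightarrow> real.
     (\<forall>z\<in>UNIV \<times> {0<..<1}. u z > 0) \<and>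
     smooth_on (UNIV \<times> {0<..<1}) u \<and>
     set_integrable lborel (UNIV \<times> {0<..<1}) (\<lambda>z. u z powr lam) \<and>
     (\<forall>x. \<forall>t\<in>{0<..<1}.
        0 \<le> time_deriv u x t - laplacian u x t \<and>
        ennreal (time_deriv u x t - laplacian u x t) \<le>
          (\<integral>\<^sup>+ w\<in>UNIV \<times> {0<..<1}.
              ennreal (heat_kernel (x - fst w) (t - snd w) powr (\<alpha> / real DIM('a))
                       * u w powr lam) \<partial>lborel)
          * ennreal (u (x, t) powr \<sigma>)) \<and>
     (\<lambda>t. u (0, t)) \<notin> O[at_right 0](\<phi>)"
proof -
  define n where "n = real DIM('a)"
  have n: "n > 0" by (simp add: n_def)
  note asms = assms(1-5)[folded n_def]
  \<comment> \<open>From \<open>\<alpha> < n + 2\<close> the lower bound for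
    \<open>lam + \<sigma>\<close> exceeds \<open>(n + 2) / n\<close>, which in turn exceeds
    \<open>lam\<close>.\<close>
  have \<sigma>: "\<sigma> > 0"
  proof -
    have "(n + 2) / n \<le> (2 * (n + 2) - \<alpha>) / n"
      using n asms by (intro divide_right_mono) auto
    then show ?thesis using asms by linarith
  qed
  define E where "E = lam + \<sigma>"
  have E: "E > 0" using asms \<sigma> by (simp add: E_def)
  \<comment> \<open>\<open>A\<close> is the value of \<open>\<delta>\<close> at
    \<open>\<eta> = 0\<close>, and \<open>n / 2\<close> times the slack in the hypothesis on
    \<open>\<sigma>\<close>.\<close>
  define A where "A = n * E / 2 - (n + 2) + \<alpha> / 2"
  have A: "A > 0"
  proof -
    have "(2 * (n + 2) - \<alpha>) / n < E" using asms by (simp add: E_def)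
    then show ?thesis using n by (simp add: A_def field_simps)
  qed
  \<comment> \<open>The first bound costs at most half of \<open>A\<close> in
    \<open>\<delta> = A + \<eta> - \<eta> * E\<close>; the second keeps
    \<open>\<eta> - n / 2\<close> negative, so that the heights grow along a ladder.\<close>
  define \<eta> where "\<eta> = min (A / (2 * E)) (n / 4)"
  have \<eta>: "0 < \<eta>" "\<eta> < n / 2" using A E n by (auto simp: \<eta>_def)
  define \<delta> where "\<delta> = \<eta> - 1 - n / 2 - (1 + n / 2 - \<alpha> / 2 + (\<eta> - n / 2) * E)"
  have \<delta>: "\<delta> > 0"
  proof -
    have "\<eta> * E \<le> A / (2 * E) * E" using E by (intro mult_right_mono) (auto simp: \<eta>_def)
    then have "\<eta> * E \<le> A / 2" using E by simp
    moreover have "\<delta> = A + \<eta> - \<eta> * E" by (simp add: \<delta>_def A_def algebra_simps)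
    ultimately show ?thesis using A \<eta> by linarith
  qed
  define D where "D = 2 * \<alpha> / n + \<sigma> / 4"
  have D: "D > 0" using asms n \<sigma> by (simp add: D_def add_pos_pos)
  \<comment> \<open>The bound \<open>1 / 16\<close> serves the schedule, and
    \<open>1 / (8 * D)\<close> gives the domination of Gaussians in
    \<open>source_estimate\<close>.\<close>
  define c where "c = min (1 / 16) (1 / (8 * D))"
  have c: "0 < c" "c \<le> 1 / 16" using D by (auto simp: c_def)
  have "D \<le> 1 / (8 * c)"
  proof -
    have "c \<le> 1 / (8 * D)" by (simp add: c_def)
    then show ?thesis using c D by (simp add: field_simps)
  qed
  then have c': "2 * \<alpha> / real DIM('a) + \<sigma> / 4 \<le> 1 / (8 * c)" by (simp add: D_def n_def)
  obtain B where B: "B > 0" "\<And>t. step' t \<le> B" using step'_bounded by blast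
  have c2: "c \<le> 1 / 2" using c by simp
  obtain K where K: "K > 0"
    "\<And>u s r t (x::'a). \<lbrakk>0 < r; r \<le> s; s \<le> t; t \<le> s + c * r; t < 1;
      \<And>y q. s - r / 2 \<le> q \<Longrightarrow> q \<le> t \<Longrightarrow> r powr \<eta> * heat_kernel y (q - s + r) \<le> u (y, q)\<rbrakk> \<Longrightarrow>
      ennreal (r powr \<eta> * (B / (c * r) * heat_kernel x (t - (s - c * r))))
        \<le> ennreal (K * r powr \<delta>) * (potential \<alpha> lam u x t * ennreal (u (x, t) powr \<sigma>))"
    unfolding \<delta>_def n_def E_def
    by (rule source_estimate[where ?'a = 'a and \<eta> = \<eta>, OF asms(1,3) \<sigma> B(1) c(1) c2 c']) blast
  \<comment> \<open>The sum of all ratios factors as \<open>K * (T powr \<delta> * G)\<close> with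
    \<open>G\<close> independent of \<open>T\<close>, so a small \<open>T\<close> brings it below
    1.\<close>
  define G where "G = (\<Sum>i. ((4 * c) powr \<delta>) ^ (fst (prod_decode i) + snd (prod_decode i)))"
  have "((\<lambda>T. K * (T powr \<delta> * G)) \<longlongrightarrow> 0) (at_right 0)"
    using \<delta> by real_asymp
  then have T1: "\<forall>\<^sub>F T in at_right 0. K * (T powr \<delta> * G) < 1"
    by (rule order_tendstoD(2)) simp
  have T2: "\<forall>\<^sub>F T in at_right (0::real). 0 < T \<and> T < 1 / 4"
    by (auto simp: eventually_at_right[OF zero_less_one] intro!: exI[of _ "1/4"])
  obtain T where T: "K * (T powr \<delta> * G) < 1" "0 < T" "T < 1 / 4"
    using eventually_happens'[OF _ eventually_conj[OF T1 T2]] by auto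
  \<comment> \<open>The interval is the time window of burst \<open>j\<close>, and \<open>N\<close>
    is a stage tall enough for the whole window. The exponent \<open>\<eta> - n / 2 - \<eta>\<close>
    is \<open>- n / 2\<close> in the form of \<open>filterlim_peak\<close>.\<close>
  have "\<forall>j. \<exists>N. \<forall>q\<in>{T * (4 * c) ^ j .. 2 * (T * (4 * c) ^ j)}.
      real j * \<phi> q \<le> (T * (4 * c) ^ (j + N)) powr \<eta> * (8 * pi * c * (T * (4 * c) ^ (j + N))) powr (\<eta> - n / 2 - \<eta>)"
  proof (rule allI, rule exists_tall_stage[OF _ _ _ assms(6)])
    fix j
    have "T * (4 * c) ^ j \<le> T * 1" using T c by (intro mult_left_mono power_le_one) auto
    then show "2 * (T * (4 * c) ^ j) < 1" using T by linarith
    show "filterlim (\<lambda>k. (T * (4 * c) ^ (j + k)) powr \<eta> *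
       (8 * pi * c * (T * (4 * c) ^ (j + k))) powr (\<eta> - n / 2 - \<eta>)) at_top sequentially"
      using c T \<eta> by (intro filterlim_peak) auto
  qed (use T c in auto)
  from choice[OF this] obtain N where N: "\<forall>j. \<forall>q\<in>{T * (4 * c) ^ j .. 2 * (T * (4 * c) ^ j)}.
      real j * \<phi> q \<le> (T * (4 * c) ^ (j + N j)) powr \<eta> *
        (8 * pi * c * (T * (4 * c) ^ (j + N j))) powr (\<eta> - n / 2 - \<eta>)"
    by blast
  interpret burst_schedule T c \<eta> N
    by standard (use c T \<eta> in auto)
  have small: "K * (\<Sum>i. case prod_decode i of (j, k) \<Rightarrow> scale j k powr \<delta>) \<le> 1"
    unfolding suminf_scale_powr[OF \<delta>] G_def[symmetric] using T by simp
  show ?thesis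
  proof (rule exI[of _ train], intro conjI ballI allI)
    show "train z > 0" if "z \<in> UNIV \<times> {0<..<1}" for z :: "'a \<times> real"
      using that by (intro train_pos) auto
    show "smooth_on (UNIV \<times> {0<..<1}) (train :: 'a \<times> real \<Rightarrow> real)"
      by (rule smooth_on_subset[OF smooth_on_train]) auto
    show "set_integrable lborel (UNIV \<times> {0<..<1}) (\<lambda>z::'a \<times> real. train z powr lam)"
    proof (rule set_integrable_train_powr[OF assms(3,4)])
      show "summable (\<lambda>i. sqrt (mass i))"
        using summable_mass_powr[of "1 / 2"] mass_nonneg by (simp add: powr_half_sqrt)
      show "summable (\<lambda>i. mass i powr (lam / 2))"
        using assms(3) by (intro summable_mass_powr) simp
    qed
    show "(\<lambda>t. train (0::'a, t)) \<notin> O[at_right 0](\<phi>)"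
      using N by (intro train_not_bigo assms(7)) (simp add: scale_def n_def)
    fix x :: 'a and t :: real assume t: "t \<in> {0<..<1}"
    show "0 \<le> time_deriv train x t - laplacian train x t"
    proof -
      have "(\<lambda>i. source i (x, t)) sums heat_op train (x, t)" using t by (intro heat_op_train_sums) simp
      then show ?thesis
        unfolding heat_op_eq using suminf_nonneg[of "\<lambda>i. source i (x, t)"] source_nonneg[of _ "(x, t)"]
        by (simp add: sums_iff)
    qed
    show "ennreal (time_deriv train x t - laplacian train x t) \<le>
          (\<integral>\<^sup>+ w\<in>UNIV \<times> {0<..<1}.
              ennreal (heat_kernel (x - fst w) (t - snd w) powr (\<alpha> / real DIM('a))
                       * train w powr lam) \<partial>lborel)
          * ennreal (train (x, t) powr \<sigma>)"
      unfolding heat_op_eq potential_def[symmetric]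
    proof (rule heat_op_train_le[where B = B and K = K and \<delta> = \<delta>])
      show "ennreal (r powr \<eta> * (B / (c * r) * heat_kernel x (t - (s - c * r))))
        \<le> ennreal (K * r powr \<delta>) * (potential \<alpha> lam u x t * ennreal (u (x, t) powr \<sigma>))"
        if "0 < r" "r \<le> s" "s \<le> t" "t \<le> s + c * r" "t < 1"
          "\<And>y q. s - r / 2 \<le> q \<Longrightarrow> q \<le> t \<Longrightarrow> r powr \<eta> * heat_kernel y (q - s + r) \<le> u (y, q)"
        for u s r t and x :: 'a
        by (rule K(2)) (fact that)+
    qed (use t K(1) B(2) \<delta> small in auto)
  qed
qed

end
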